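(* Let $(M,g,f,\lambda)$ be an oriented $4$-dimensional gradient Ricci soliton satisfying $\mathrm{Ric}_g+\mathrm{Hess} f=\frac{\lambda}{2}g$. If $S$ is a section of $\Lambda^-_g\otimes\Lambda^+_g$, $u$ is a function, and $h=u\,g+\mathrm{tr}(S)$, then $$L_f h=(\Delta_f u)\,g+2u\,\mathrm{Ric}+\mathrm{tr}\Big(\Delta^L_{H,f,0}S+S\circ\big(W^++\big(\lambda-\tfrac{\mathrm{scal}}{3}\big)\mathrm{Id}_{\Lambda^+_g}\big)\Big).$$
   Context: All objects are smooth. Index notation is with respect to a local orthonormal frame $e_i$ with summation over repeated indices. $\Lambda^2=\Lambda^+_g\oplus\Lambda^-_g$ is the decomposition into self-dual and anti-self-dual $2$-forms. For sections $T,U$ of $\Lambda^2\otimes\Lambda^2$: $(T\circ U)_{ijkl}=T_{ijpq}U_{pqkl}$; $T$ acts on $2$-forms by $T(\phi)_{ij}=T_{ijkl}\phi_{kl}$; and $\mathrm{tr}(T)_{ik}=\frac12(T_{ipkp}+T_{kpip})$, a symmetric $2$-tensor. The Kulkarni–Nomizu product is $(A\mathbin{\bigcirc\!\!\!\!\wedge}B)_{ijkl}=A_{ik}B_{jl}-A_{il}B_{jk}-A_{jk}B_{il}+A_{jl}B_{ik}$ (denoted $\mathbin{\bigcirc\!\!\!\!\wedge}$), so $\mathrm{Id}_{\Lambda^2}=\frac14 g\mathbin{\bigcirc\!\!\!\!\wedge}g$. The curvature decomposition is $R=\frac12\mathring{\mathrm{Ric}}\mathbin{\bigcirc\!\!\!\!\wedge}g+W+\frac{\mathrm{scal}}{6}\mathrm{Id}_{\Lambda^2}$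 with $\mathrm{Ric}_{ik}=R_{ijkj}$ (positive on round spheres), $\mathring{\mathrm{Ric}}$ the traceless Ricci tensor, and Weyl tensor $W=W^++W^-$, $W^\pm\in\Lambda^\pm_g\otimes\Lambda^\pm_g$. $L_f h=\Delta_f h+2R(h)$, with $\Delta_f=\Delta-\nabla_{\nabla f}$ ($\Delta=\mathrm{tr}\,\nabla^2$) and $R(h)_{ik}=R_{ijkl}h_{jl}$. On sections of $\Lambda^k\otimes\Lambda^l$ (viewed as $\Lambda^l$-valued $k$-forms, with Levi-Civita connection), $d^L=e^i\wedge\nabla_{e_i}$ and $\delta^L=-\iota_{e_i}\nabla_{e_i}$, where $\wedge$ and $\iota$ act on the first (left) factor and are normalized so that $\iota_{e_i}(e^j\wedge\cdot)+e^j\wedge\iota_{e_i}(\cdot)=\delta_i^j$. Set $\delta^L_{f,0}:=e^f\delta^L(e^{-f}\,\cdot)=\delta^L+\iota_{\nabla f}$ and $\Delta^L_{H,f,0}:=-(d^L\delta^L_{f,0}+\delta^L_{f,0}d^L)$. *)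

theory Defs
  imports "HOL-Analysis.Analysis"
begin

section \<open>Smooth functions on open subsets of $\mathbb R^4$\<close>

definition partial :: "4 \<Rightarrow> (real^4 \<Rightarrow> real) \<Rightarrow> real^4 \<Rightarrow> real" where
  "partial a F x = frechet_derivative F (at x) (axis a 1)"

primrec Ck_on :: "nat \<Rightarrow> (real^4) set \<Rightarrow> (real^4 \<Rightarrow> real) \<Rightarrow> bool" where
  "Ck_on 0 V F \<longleftrightarrow> continuous_on V F"
| "Ck_on (Suc k) V F \<longleftrightarrow> (\<forall>x\<in>V. F differentiable (at x)) \<and> (\<forall>a. Ck_on k V (partial a F))"

definition smooth_on :: "(real^4) set \<Rightarrow> (real^4 \<Rightarrow> real) \<Rightarrow> bool" where
  "smooth_on V F \<longleftrightarrow> (\<forall>k. Ck_on k V F)"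


section \<open>Oriented smooth 4-manifolds and covariant tensor fields\<close>

text \<open>A chart is a pair of its domain and its coordinate map. The underlying space of the manifold
  is a whole type; the smooth structure and the orientation are given by an atlas.\<close>

type_synonym 'm chart = "'m set \<times> ('m \<Rightarrow> real^4)"

definition chart_inv :: "'m chart \<Rightarrow> real^4 \<Rightarrow> 'm" where
  "chart_inv c = inv_into (fst c) (snd c)"

text \<open>The derivative of a function on the manifold along the \<open>a\<close>-th coordinate vector field of
  the chart \<open>c\<close>.\<close>

definition pd :: "'m chart \<Rightarrow> 4 \<Rightarrow> ('m \<Rightarrow> real) \<Rightarrow> 'm \<Rightarrow> real" where
  "pd c a F p = partial a (F \<circ> chart_inv c) (snd c p)"

definition oriented_atlas :: "('m::{t2_space,second_countable_topology}) chart set \<Rightarrow> bool" where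
  "oriented_atlas A \<longleftrightarrow>
     (\<Union>c\<in>A. fst c) = UNIV \<and>
     (\<forall>c\<in>A. open (fst c) \<and> open (snd c ` fst c) \<and>
        homeomorphism (fst c) (snd c ` fst c) (snd c) (chart_inv c)) \<and>
     (\<forall>c\<in>A. \<forall>c'\<in>A.
        (\<forall>j. smooth_on (snd c' ` (fst c \<inter> fst c')) (\<lambda>x. snd c (chart_inv c' x) $ j)) \<and>
        (\<forall>p\<in>fst c \<inter> fst c'. det (\<chi> i j. pd c' i (\<lambda>q. snd c q $ j) p) > 0))"

definition smooth_function :: "'m chart set \<Rightarrow> ('m \<Rightarrow> real) \<Rightarrow> bool" where
  "smooth_function A u \<longleftrightarrow> (\<forall>c\<in>A. smooth_on (snd c ` fst c) (u \<circ> chart_inv c))"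

text \<open>A covariant tensor field is given by its components: \<open>T c [i\<^sub>1, \<dots>, i\<^sub>k] p\<close> is the value at \<open>p\<close>
  on the coordinate vectors \<open>\<partial>\<^bsub>i\<^sub>1\<^esub>, \<dots>, \<partial>\<^bsub>i\<^sub>k\<^esub>\<close> of the chart \<open>c\<close>. Only index lists of length equal to
  the rank, charts of the atlas and points of the chart domain are meaningful.\<close>

type_synonym 'm tensor = "'m chart \<Rightarrow> 4 list \<Rightarrow> 'm \<Rightarrow> real"

definition tensor_field :: "'m chart set \<Rightarrow> nat \<Rightarrow> 'm tensor \<Rightarrow> bool" where
  "tensor_field A k T \<longleftrightarrow>
     (\<forall>c\<in>A. \<forall>is. length is = k \<longrightarrow> smooth_on (snd c ` fst c) (T c is \<circ> chart_inv c)) \<and>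
     (\<forall>c\<in>A. \<forall>c'\<in>A. \<forall>p\<in>fst c \<inter> fst c'. \<forall>is. length is = k \<longrightarrow>
        T c' is p =
          (\<Sum>js\<in>{js. length js = k}. (\<Prod>r<k. pd c' (is ! r) (\<lambda>q. snd c q $ (js ! r)) p) * T c js p))"

definition scalar :: "('m \<Rightarrow> real) \<Rightarrow> 'm tensor" where
  "scalar u c is p = (case is of [] \<Rightarrow> u p | _ \<Rightarrow> 0)"


section \<open>Riemannian metrics and the Levi-Civita connection\<close>

definition metric_matrix :: "'m tensor \<Rightarrow> 'm chart \<Rightarrow> 'm \<Rightarrow> real^4^4" where
  "metric_matrix g c p = (\<chi> i j. g c [i, j] p)"

definition riemannian_metric :: "'m chart set \<Rightarrow> 'm tensor \<Rightarrow> bool" where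
  "riemannian_metric A g \<longleftrightarrow> tensor_field A 2 g \<and>
     (\<forall>c\<in>A. \<forall>p\<in>fst c. (\<forall>i j. g c [i, j] p = g c [j, i] p) \<and>
        (\<forall>v. v \<noteq> 0 \<longrightarrow> v \<bullet> (metric_matrix g c p *v v) > 0))"

text \<open>Repeated indices of an orthonormal frame become contractions with the inverse metric in
  coordinates.\<close>

definition ginv :: "'m tensor \<Rightarrow> 'm chart \<Rightarrow> 4 \<Rightarrow> 4 \<Rightarrow> 'm \<Rightarrow> real" where
  "ginv g c a b p = matrix_inv (metric_matrix g c p) $ a $ b"

definition christoffel :: "'m tensor \<Rightarrow> 'm chart \<Rightarrow> 4 \<Rightarrow> 4 \<Rightarrow> 4 \<Rightarrow> 'm \<Rightarrow> real" where
  "christoffel g c m a b p =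
     (\<Sum>l\<in>UNIV. ginv g c m l p * (pd c a (g c [l, b]) p + pd c b (g c [l, a]) p - pd c l (g c [a, b]) p)) / 2"

text \<open>The covariant derivative; the direction of differentiation is the new first index.\<close>

definition cov :: "'m tensor \<Rightarrow> 'm tensor \<Rightarrow> 'm tensor" where
  "cov g T c is p = (case is of
       a # js \<Rightarrow> pd c a (T c js) p
         - (\<Sum>r<length js. \<Sum>m\<in>UNIV. christoffel g c m a (js ! r) p * T c (js[r := m]) p)
     | [] \<Rightarrow> 0)"

definition lap :: "'m tensor \<Rightarrow> 'm tensor \<Rightarrow> 'm tensor" where
  "lap g T c is p = (\<Sum>a\<in>UNIV. \<Sum>b\<in>UNIV. ginv g c a b p * cov g (cov g T) c (a # b # is) p)"

definition cov_grad :: "'m tensor \<Rightarrow> ('m \<Rightarrow> real) \<Rightarrow> 'm tensor \<Rightarrow> 'm tensor" where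
  "cov_grad g f T c is p = (\<Sum>a\<in>UNIV. \<Sum>b\<in>UNIV. ginv g c a b p * pd c a f p * cov g T c (b # is) p)"

definition lap_f :: "'m tensor \<Rightarrow> ('m \<Rightarrow> real) \<Rightarrow> 'm tensor \<Rightarrow> 'm tensor" where
  "lap_f g f T c is p = lap g T c is p - cov_grad g f T c is p"

definition hess :: "'m tensor \<Rightarrow> ('m \<Rightarrow> real) \<Rightarrow> 'm tensor" where
  "hess g f = cov g (cov g (scalar f))"


section \<open>Curvature\<close>

text \<open>\<open>R\<^sub>i\<^sub>j\<^sub>k\<^sub>l = g(\<nabla>\<^sub>i \<nabla>\<^sub>j \<partial>\<^sub>l - \<nabla>\<^sub>j \<nabla>\<^sub>i \<partial>\<^sub>l, \<partial>\<^sub>k)\<close>, so that \<open>R\<^sub>i\<^sub>j\<^sub>i\<^sub>j > 0\<close> on round spheres.\<close>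

definition riem :: "'m tensor \<Rightarrow> 'm tensor" where
  "riem g c is p = (case is of [i, j, k, l] \<Rightarrow>
       (\<Sum>m\<in>UNIV. g c [k, m] p *
          (pd c i (christoffel g c m j l) p - pd c j (christoffel g c m i l) p
           + (\<Sum>q\<in>UNIV. christoffel g c m i q p * christoffel g c q j l p
                       - christoffel g c m j q p * christoffel g c q i l p)))
     | _ \<Rightarrow> 0)"

definition ric :: "'m tensor \<Rightarrow> 'm tensor" where
  "ric g c is p = (case is of [i, k] \<Rightarrow>
       (\<Sum>j\<in>UNIV. \<Sum>l\<in>UNIV. ginv g c j l p * riem g c [i, j, k, l] p) | _ \<Rightarrow> 0)"

definition scal :: "'m tensor \<Rightarrow> 'm chart \<Rightarrow> 'm \<Rightarrow> real" where
  "scal g c p = (\<Sum>i\<in>UNIV. \<Sum>k\<in>UNIV. ginv g c i k p * ric g c [i, k] p)"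

definition ric0 :: "'m tensor \<Rightarrow> 'm tensor" where
  "ric0 g c is p = ric g c is p - scal g c p / 4 * g c is p"

definition kulkarni_nomizu :: "'m tensor \<Rightarrow> 'm tensor \<Rightarrow> 'm tensor" where
  "kulkarni_nomizu S T c is p = (case is of [i, j, k, l] \<Rightarrow>
       S c [i, k] p * T c [j, l] p - S c [i, l] p * T c [j, k] p
       - S c [j, k] p * T c [i, l] p + S c [j, l] p * T c [i, k] p
     | _ \<Rightarrow> 0)"

definition id2 :: "'m tensor \<Rightarrow> 'm tensor" where
  "id2 g c is p = kulkarni_nomizu g g c is p / 4"

definition weyl :: "'m tensor \<Rightarrow> 'm tensor" where
  "weyl g c is p =
     riem g c is p - kulkarni_nomizu (ric0 g) g c is p / 2 - scal g c p / 6 * id2 g c is p"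

text \<open>The action of the curvature on symmetric 2-tensors.\<close>

definition curv_act :: "'m tensor \<Rightarrow> 'm tensor \<Rightarrow> 'm tensor" where
  "curv_act g h c is p = (case is of [i, k] \<Rightarrow>
       (\<Sum>j\<in>UNIV. \<Sum>j'\<in>UNIV. \<Sum>l\<in>UNIV. \<Sum>l'\<in>UNIV.
          ginv g c j j' p * ginv g c l l' p * riem g c [i, j, k, l] p * h c [j', l'] p)
     | _ \<Rightarrow> 0)"

definition L_op :: "'m tensor \<Rightarrow> ('m \<Rightarrow> real) \<Rightarrow> 'm tensor \<Rightarrow> 'm tensor" where
  "L_op g f h c is p = lap_f g f h c is p + 2 * curv_act g h c is p"


section \<open>Two-forms and sections of $\Lambda^2\otimes\Lambda^2$\<close>

definition comp2 :: "'m tensor \<Rightarrow> 'm tensor \<Rightarrow> 'm tensor \<Rightarrow> 'm tensor" where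
  "comp2 g T U c is p = (case is of [i, j, k, l] \<Rightarrow>
       (\<Sum>a\<in>UNIV. \<Sum>a'\<in>UNIV. \<Sum>b\<in>UNIV. \<Sum>b'\<in>UNIV.
          ginv g c a a' p * ginv g c b b' p * T c [i, j, a, b] p * U c [a', b', k, l] p)
     | _ \<Rightarrow> 0)"

definition act2 :: "'m tensor \<Rightarrow> 'm tensor \<Rightarrow> 'm tensor \<Rightarrow> 'm tensor" where
  "act2 g T \<phi> c is p = (case is of [i, j] \<Rightarrow>
       (\<Sum>k\<in>UNIV. \<Sum>k'\<in>UNIV. \<Sum>l\<in>UNIV. \<Sum>l'\<in>UNIV.
          ginv g c k k' p * ginv g c l l' p * T c [i, j, k, l] p * \<phi> c [k', l'] p)
     | _ \<Rightarrow> 0)"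

definition tr2 :: "'m tensor \<Rightarrow> 'm tensor \<Rightarrow> 'm tensor" where
  "tr2 g T c is p = (case is of [i, k] \<Rightarrow>
       (\<Sum>a\<in>UNIV. \<Sum>b\<in>UNIV. ginv g c a b p * (T c [i, a, k, b] p + T c [k, a, i, b] p)) / 2
     | _ \<Rightarrow> 0)"

definition vol :: "'m tensor \<Rightarrow> 'm tensor" where
  "vol g c is p = (case is of [i, j, k, l] \<Rightarrow>
       sqrt (det (metric_matrix g c p)) * det (vector [axis i 1, axis j 1, axis k 1, axis l 1] :: real^4^4)
     | _ \<Rightarrow> 0)"

text \<open>The Hodge star on 2-forms, \<open>(\<star>\<phi>)\<^sub>i\<^sub>j = \<epsilon>\<^sub>i\<^sub>j\<^sub>k\<^sub>l \<phi>\<^sub>k\<^sub>l / 2\<close>, as a section of \<open>\<Lambda>\<^sup>2 \<otimes> \<Lambda>\<^sup>2\<close>.\<close>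

definition star :: "'m tensor \<Rightarrow> 'm tensor" where
  "star g c is p = vol g c is p / 2"

definition two_form :: "'m chart set \<Rightarrow> 'm tensor \<Rightarrow> bool" where
  "two_form A \<phi> \<longleftrightarrow> (\<forall>c\<in>A. \<forall>p\<in>fst c. \<forall>i j. \<phi> c [i, j] p = - \<phi> c [j, i] p)"

definition self_dual :: "'m chart set \<Rightarrow> 'm tensor \<Rightarrow> 'm tensor \<Rightarrow> bool" where
  "self_dual A g \<phi> \<longleftrightarrow> two_form A \<phi> \<and>
     (\<forall>c\<in>A. \<forall>p\<in>fst c. \<forall>i j. act2 g (star g) \<phi> c [i, j] p = \<phi> c [i, j] p)"

definition anti_self_dual :: "'m chart set \<Rightarrow> 'm tensor \<Rightarrow> 'm tensor \<Rightarrow> bool" where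
  "anti_self_dual A g \<phi> \<longleftrightarrow> two_form A \<phi> \<and>
     (\<forall>c\<in>A. \<forall>p\<in>fst c. \<forall>i j. act2 g (star g) \<phi> c [i, j] p = - \<phi> c [i, j] p)"

text \<open>Sections of \<open>\<Lambda>\<^sup>- \<otimes> \<Lambda>\<^sup>+\<close>. Duality is a pointwise condition in each chart, so it may be imposed
  on slices of the component array although these are not tensor fields.\<close>

definition asd_sd_section :: "'m chart set \<Rightarrow> 'm tensor \<Rightarrow> 'm tensor \<Rightarrow> bool" where
  "asd_sd_section A g S \<longleftrightarrow> tensor_field A 4 S \<and>
     (\<forall>k l. anti_self_dual A g (\<lambda>c is. S c (is @ [k, l]))) \<and>
     (\<forall>i j. self_dual A g (\<lambda>c is. S c ([i, j] @ is)))"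

text \<open>\<open>Id\<^bsub>\<Lambda>\<^sup>+\<^esub>\<close>, extended by zero on \<open>\<Lambda>\<^sup>-\<close>, and the component of the Weyl tensor in \<open>\<Lambda>\<^sup>+ \<otimes> \<Lambda>\<^sup>+\<close>.\<close>

definition id_plus :: "'m tensor \<Rightarrow> 'm tensor" where
  "id_plus g c is p = (id2 g c is p + star g c is p) / 2"

definition weyl_plus :: "'m tensor \<Rightarrow> 'm tensor" where
  "weyl_plus g = comp2 g (id_plus g) (comp2 g (weyl g) (id_plus g))"


section \<open>The Hodge Laplacian on the left factor of $\Lambda^k\otimes\Lambda^l$\<close>

text \<open>\<open>e\<^sup>a \<and> \<nabla>\<^sub>a T\<close>, where the first \<open>k\<close> indices of \<open>T\<close> are the form indices of the left factor and
  \<open>e\<^sup>a \<and> \<alpha>\<close> is the alternating sum over the \<open>k + 1\<close> positions of the new index; this is the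
  normalization in which interior multiplication inserts a vector into the first slot and
  \<open>\<iota>\<^sub>i (e\<^sup>j \<and> \<alpha>) + e\<^sup>j \<and> \<iota>\<^sub>i \<alpha> = \<delta>\<^sub>i\<^sup>j \<alpha>\<close>.\<close>

definition dL :: "'m tensor \<Rightarrow> nat \<Rightarrow> 'm tensor \<Rightarrow> 'm tensor" where
  "dL g k T c is p = (\<Sum>r\<le>k. (- 1) ^ r * cov g T c (is ! r # take r is @ drop (Suc r) is) p)"

definition deltaL :: "'m tensor \<Rightarrow> 'm tensor \<Rightarrow> 'm tensor" where
  "deltaL g T c is p = - (\<Sum>a\<in>UNIV. \<Sum>b\<in>UNIV. ginv g c a b p * cov g T c (a # b # is) p)"

definition deltaL_f :: "'m tensor \<Rightarrow> ('m \<Rightarrow> real) \<Rightarrow> 'm tensor \<Rightarrow> 'm tensor" where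
  "deltaL_f g f T c is p = exp (f p) * deltaL g (\<lambda>c is p. exp (- f p) * T c is p) c is p"

text \<open>The operator on sections of \<open>\<Lambda>\<^sup>k \<otimes> \<Lambda>\<^sup>l\<close> for \<open>k \<ge> 1\<close>.\<close>

definition hodge_lap_f :: "'m tensor \<Rightarrow> ('m \<Rightarrow> real) \<Rightarrow> nat \<Rightarrow> 'm tensor \<Rightarrow> 'm tensor" where
  "hodge_lap_f g f k T c is p =
     - (dL g (k - 1) (deltaL_f g f T) c is p + deltaL_f g f (dL g k T) c is p)"


section \<open>Gradient Ricci solitons\<close>

definition gradient_ricci_soliton :: "'m chart set \<Rightarrow> 'm tensor \<Rightarrow> ('m \<Rightarrow> real) \<Rightarrow> real \<Rightarrow> bool" where
  "gradient_ricci_soliton A g f lam \<longleftrightarrow> riemannian_metric A g \<and> smooth_function A f \<and>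
     (\<forall>c\<in>A. \<forall>p\<in>fst c. \<forall>i j. ric g c [i, j] p + hess g f c [i, j] p = lam / 2 * g c [i, j] p)"

end

(* The computation takes place in one chart. The part u g of h contributes (\<Delta>_f u) g + 2 u Ric, since the
   metric is parallel. Contraction commutes with \<Delta>_f, so L_f (tr S) = tr (\<Delta>_f S) + 2 R(tr S). In
   d^L \<delta>^L + \<delta>^L d^L the second covariant derivatives of S differ from the rough Laplacian by
   commutators, which the Ricci identity turns into curvature; the Ricci tensor arising there combines
   with the Hessian of f, coming from d^L \<iota>_{\<nabla>f} + \<iota>_{\<nabla>f} d^L, to the multiple \<lambda> of S. What remains is an
   identity at a point, bilinear in the curvature and in S, verified in components of an oriented
   orthonormal frame; W^+ enters it through the part of the curvature in \<Lambda>^+ \<otimes> \<Lambda>^+, to which the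
   trace-free Ricci tensor does not contribute since it exchanges \<Lambda>^+ and \<Lambda>^-. *)
theory Submission
  imports Defs
begin

section \<open>Partial derivatives and smooth functions\<close>

text \<open>All differentiation happens in coordinates, with indices contracted by the inverse
  metric, and is finished before a frame is chosen. What remains is tensorial at \<open>p\<close>,
  so an orthonormal basis of a single tangent space suffices and no frame field is ever
  differentiated. The constant scal/3 fits as follows. After composition with \<open>S\<close>, W^+
  may be replaced by the full curvature followed by projection to \<Lambda>^+, minus scal/6;
  together with -scal/3 this leaves -scal/2. The multiple \<lambda> of the composition cancels the
  -\<lambda> S from the Hodge Laplacian. The final identity thus involves neither \<lambda> nor
  \<open>f\<close>: it holds for every algebraic curvature tensor and every element of \<Lambda>^-
  \<otimes> \<Lambda>^+, and is a family of polynomial identities in their independent components.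
  An obstacle that shapes many statements: tensors are functions on index lists, and identities
  between them hold only for lists of one length and on the chart domain. They can be used under a
  derivative only through congruence rules.\<close>

lemma partial_eqI: "(F has_derivative F') (at x) \<Longrightarrow> partial a F x = F' (axis a 1)"
  unfolding partial_def by (metis frechet_derivative_at)

lemma partial_cong_open:
  assumes "open V" "x \<in> V" "\<And>y. y \<in> V \<Longrightarrow> F y = G y"
  shows "partial a F x = partial a G x"
proof -
  have "(F has_derivative F') (at x) \<longleftrightarrow> (G has_derivative F') (at x)" for F'
    using has_derivative_transform_within_open[OF _ assms(1,2), of F F' UNIV G]
      has_derivative_transform_within_open[OF _ assms(1,2), of G F' UNIV F] assms(3) by auto
  then show ?thesis by (simp add: partial_def frechet_derivative_def)
qed

lemma differentiable_cong_open:
  assumes "open V" "x \<in> V" "\<And>y. y \<in> V \<Longrightarrow> F y = G y" "F differentiable (at x)"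
  shows "G differentiable (at x)"
  using assms has_derivative_transform_within_open unfolding differentiable_def by blast

lemma partial_add:
  assumes "F differentiable (at x)" "G differentiable (at x)"
  shows "partial a (\<lambda>x. F x + G x) x = partial a F x + partial a G x"
  using has_derivative_add[OF assms[unfolded frechet_derivative_works]]
  by (simp add: partial_eqI) (simp add: partial_def)

lemma partial_mult:
  assumes "F differentiable (at x)" "G differentiable (at x)"
  shows "partial a (\<lambda>x. F x * G x) x = partial a F x * G x + F x * partial a G x"
  using has_derivative_mult[OF assms[unfolded frechet_derivative_works]]
  by (simp add: partial_eqI) (simp add: partial_def)

lemma partial_compose_real:
  assumes "F differentiable (at x)" and "(\<phi> has_real_derivative D) (at (F x))"
  shows "partial a (\<lambda>x. \<phi> (F x)) x = D * partial a F x"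
proof -
  have "((\<lambda>x. \<phi> (F x)) has_derivative (\<lambda>v. frechet_derivative F (at x) v * D)) (at x)"
    using has_derivative_in_compose[OF assms(1)[unfolded frechet_derivative_works], of \<phi> "\<lambda>y. y * D"]
      assms(2) by (simp add: has_field_derivative_def has_derivative_at_withinI mult_commute_abs)
  then show ?thesis by (simp add: partial_eqI) (simp add: partial_def)
qed

lemma partial_const [simp]: "partial a (\<lambda>x. c) x = 0"
  by (simp add: partial_def)

text \<open>The rules for \<open>partial\<close> of sums, products and inverses need
  differentiability, known only on \<open>V\<close>. The inductions below replace the derivative by
  its formula there; openness lets the equality pass to derivatives of every order.\<close>

lemma Ck_on_cong:
  assumes "open V" "\<And>x. x \<in> V \<Longrightarrow> F x = G x" "Ck_on k V F"
  shows "Ck_on k V G"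
  using assms(2,3)
proof (induction k arbitrary: F G)
  case 0
  then show ?case using continuous_on_cong by force
next
  case (Suc k)
  then have "Ck_on k V (partial a G)" for a
    using partial_cong_open[OF assms(1)] by (metis Ck_on.simps(2))
  moreover have "\<forall>x\<in>V. G differentiable (at x)"
    using Suc.prems differentiable_cong_open[OF assms(1)] by (metis Ck_on.simps(2))
  ultimately show ?case by simp
qed

text \<open>The product rule multiplies each factor by a derivative of the other, so a factor given
  at order \<open>Suc k\<close> is needed at order \<open>k\<close> as well.\<close>

lemma Ck_on_SucD: "Ck_on (Suc k) V F \<Longrightarrow> Ck_on k V F"
proof (induction k arbitrary: F)
  case 0
  then show ?case
    by (auto intro!: continuous_at_imp_continuous_on differentiable_imp_continuous_within)
next
  case (Suc k)
  then show ?case by (metis Ck_on.simps(2))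
qed

lemma Ck_on_const: "Ck_on k V (\<lambda>x. c)"
proof (induction k arbitrary: c)
  case (Suc k)
  then show ?case by (simp add: partial_const[abs_def])
qed simp

lemma Ck_on_add:
  assumes "open V"
  shows "Ck_on k V F \<Longrightarrow> Ck_on k V G \<Longrightarrow> Ck_on k V (\<lambda>x. F x + G x)"
proof (induction k arbitrary: F G)
  case 0
  then show ?case by (simp add: continuous_on_add)
next
  case (Suc k)
  have "Ck_on k V (partial a (\<lambda>x. F x + G x))" for a
    by (rule Ck_on_cong[OF assms, of "\<lambda>x. partial a F x + partial a G x"])
      (use Suc in \<open>auto simp: partial_add\<close>)
  then show ?case using Suc.prems by (simp add: differentiable_add)
qed

lemma Ck_on_mult:
  assumes "open V"
  shows "Ck_on k V F \<Longrightarrow> Ck_on k V G \<Longrightarrow> Ck_on k V (\<lambda>x. F x * G x)"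
proof (induction k arbitrary: F G)
  case 0
  then show ?case by (simp add: continuous_on_mult)
next
  case (Suc k)
  have "Ck_on k V (partial a (\<lambda>x. F x * G x))" for a
  proof (rule Ck_on_cong[OF assms, of "\<lambda>x. partial a F x * G x + F x * partial a G x"])
    have "Ck_on k V F" "Ck_on k V G" "Ck_on k V (partial a F)" "Ck_on k V (partial a G)"
      using Suc.prems Ck_on_SucD by auto
    then show "Ck_on k V (\<lambda>x. partial a F x * G x + F x * partial a G x)"
      by (intro Ck_on_add[OF assms] Suc.IH)
  qed (use Suc.prems in \<open>auto simp: partial_mult\<close>)
  then show ?case using Suc.prems by (simp add: differentiable_mult)
qed

lemma Ck_on_inverse:
  assumes "open V" and nz: "\<And>x. x \<in> V \<Longrightarrow> F x \<noteq> 0"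
  shows "Ck_on k V F \<Longrightarrow> Ck_on k V (\<lambda>x. inverse (F x))"
proof (induction k)
  case 0
  then show ?case using nz by (auto intro!: continuous_on_inverse)
next
  case (Suc k)
  have "Ck_on k V (partial a (\<lambda>x. inverse (F x)))" for a
  proof (rule Ck_on_cong[OF assms(1),
        of "\<lambda>x. (- 1) * ((inverse (F x) * inverse (F x)) * partial a F x)"])
    have "Ck_on k V (partial a F)" "Ck_on k V (\<lambda>x. inverse (F x))"
      using Suc Ck_on_SucD by auto
    then show "Ck_on k V (\<lambda>x. (- 1) * ((inverse (F x) * inverse (F x)) * partial a F x))"
      by (intro Ck_on_mult[OF assms(1)] Ck_on_const)
  next
    fix x assume "x \<in> V"
    then show "(- 1) * ((inverse (F x) * inverse (F x)) * partial a F x)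
        = partial a (\<lambda>x. inverse (F x)) x"
      using Suc.prems nz DERIV_inverse[of "F x" UNIV]
      by (simp add: partial_compose_real[of F x inverse "- (inverse (F x) * inverse (F x))"] power2_eq_square)
  qed
  then show ?case using Suc.prems nz by simp
qed

lemma has_real_derivative_line:
  assumes "F differentiable (at (x + s *\<^sub>R axis a 1))"
  shows "((\<lambda>s. F (x + s *\<^sub>R axis a 1)) has_real_derivative partial a F (x + s *\<^sub>R axis a 1)) (at s)"
proof -
  let ?F' = "frechet_derivative F (at (x + s *\<^sub>R axis a 1))"
  have "((\<lambda>s. F (x + s *\<^sub>R axis a 1)) has_derivative (\<lambda>t. ?F' (t *\<^sub>R axis a 1))) (at s)"
    by (rule has_derivative_in_compose[where f = "\<lambda>s. x + s *\<^sub>R axis a 1"])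
      (auto intro!: derivative_eq_intros
        has_derivative_at_withinI[OF assms[unfolded frechet_derivative_works]])
  moreover have "?F' (t *\<^sub>R axis a 1) = t * partial a F (x + s *\<^sub>R axis a 1)" for t
    using linear_frechet_derivative[OF assms] by (simp add: partial_def linear_scale)
  ultimately show ?thesis by (simp add: has_field_derivative_def mult_commute_abs)
qed

text \<open>Two applications of the mean value theorem to the second difference of \<open>F\<close>.\<close>

lemma second_difference_eq:
  assumes F: "\<And>y. y \<in> cball x (2 * h) \<Longrightarrow> F differentiable (at y)"
    "\<And>y. y \<in> cball x (2 * h) \<Longrightarrow> partial a F differentiable (at y)"
    and h: "h > 0"
  shows "\<exists>y \<in> cball x (2 * h).
    F (x + h *\<^sub>R axis a 1 + h *\<^sub>R axis b 1) - F (x + h *\<^sub>R axis a 1) - F (x + h *\<^sub>R axis b 1) + F x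
    = h * h * partial b (partial a F) y"
proof -
  have mem: "x + s *\<^sub>R axis a 1 + t *\<^sub>R axis b 1 \<in> cball x (2 * h)"
    if "0 \<le> s" "s \<le> h" "0 \<le> t" "t \<le> h" for s t
  proof -
    have "norm (s *\<^sub>R (axis a 1 :: real^4) + t *\<^sub>R axis b 1) \<le> s + t"
      by (rule norm_triangle_le) (use that in \<open>simp add: norm_axis_1\<close>)
    then show ?thesis using that by (simp add: dist_norm norm_minus_commute algebra_simps)
  qed
  \<comment> \<open>The difference in direction \<open>b\<close>, as a function of the shift in
    direction \<open>a\<close>; its increment from 0 to \<open>h\<close> is the whole second
    difference.\<close>
  let ?\<phi> = "\<lambda>s. F (x + h *\<^sub>R axis b 1 + s *\<^sub>R axis a 1) - F (x + s *\<^sub>R axis a 1)"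
  let ?\<phi>' = "\<lambda>s. partial a F (x + h *\<^sub>R axis b 1 + s *\<^sub>R axis a 1) - partial a F (x + s *\<^sub>R axis a 1)"
  have "(?\<phi> has_real_derivative ?\<phi>' s) (at s)" if "0 \<le> s" "s \<le> h" for s
    using mem[OF that, of h] mem[OF that, of 0] h that
    by (intro DERIV_diff has_real_derivative_line F) (auto simp: add_ac)
  then obtain \<sigma> where \<sigma>: "0 < \<sigma>" "\<sigma> < h" "?\<phi> h - ?\<phi> 0 = (h - 0) * ?\<phi>' \<sigma>"
    using MVT2[OF h, of ?\<phi> ?\<phi>'] by blast
  let ?\<psi> = "\<lambda>t. partial a F (x + \<sigma> *\<^sub>R axis a 1 + t *\<^sub>R axis b 1)"
  let ?\<psi>' = "\<lambda>t. partial b (partial a F) (x + \<sigma> *\<^sub>R axis a 1 + t *\<^sub>R axis b 1)"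
  have "(?\<psi> has_real_derivative ?\<psi>' t) (at t)" if "0 \<le> t" "t \<le> h" for t
    using mem[of \<sigma> t] \<sigma> that by (intro has_real_derivative_line F) auto
  then obtain \<tau> where \<tau>: "0 < \<tau>" "\<tau> < h" "?\<psi> h - ?\<psi> 0 = (h - 0) * ?\<psi>' \<tau>"
    using MVT2[OF h, of ?\<psi> ?\<psi>'] by blast
  have "?\<phi>' \<sigma> = h * ?\<psi>' \<tau>" using \<tau>(3) by (simp add: add_ac)
  then have "?\<phi> h - ?\<phi> 0 = h * h * ?\<psi>' \<tau>" using \<sigma>(3) by simp
  then show ?thesis
    using mem[of \<sigma> \<tau>] \<sigma> \<tau>
    by (intro bexI[where x = "x + \<sigma> *\<^sub>R axis a 1 + \<tau> *\<^sub>R axis b 1"]) (auto simp: algebra_simps)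
qed

text \<open>The second difference is symmetric in the two directions, so the two mixed derivatives
  agree at points \<open>y\<close> and \<open>z\<close>, possibly distinct but both close to
  \<open>x\<close>. Continuity at \<open>x\<close> then rules out a gap between the values
  there.\<close>

lemma partial_commute:
  assumes V: "open V" "x \<in> V" and F: "Ck_on 2 V F"
  shows "partial a (partial b F) x = partial b (partial a F) x"
proof (rule ccontr)
  let ?A = "partial a (partial b F)" and ?B = "partial b (partial a F)"
  assume ne: "?A x \<noteq> ?B x"
  define e where "e = \<bar>?A x - ?B x\<bar> / 2"
  have e: "e > 0" using ne by (simp add: e_def)
  have Ck: "\<And>c d. continuous_on V (partial c (partial d F))"
    "\<And>y. y \<in> V \<Longrightarrow> F differentiable (at y)"
    "\<And>c y. y \<in> V \<Longrightarrow> partial c F differentiable (at y)"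
    using F by (auto simp: numeral_2_eq_2)
  have "isCont ?A x" "isCont ?B x"
    using Ck(1) V by (auto simp: continuous_on_eq_continuous_at)
  then obtain d1 d2 where d1: "d1 > 0" "\<And>y. dist y x < d1 \<Longrightarrow> dist (?A y) (?A x) < e"
    and d2: "d2 > 0" "\<And>y. dist y x < d2 \<Longrightarrow> dist (?B y) (?B x) < e"
    using e unfolding continuous_at_eps_delta by (metis dist_real_def dist_norm)
  obtain r where r: "r > 0" "cball x r \<subseteq> V" using V open_contains_cball by blast
  \<comment> \<open>The mean value points lie within \<open>2 * h\<close> of \<open>x\<close>; a
    third keeps that distance strictly below \<open>d1\<close> and \<open>d2\<close>.\<close>
  define h where "h = min r (min d1 d2) / 3"
  have h: "h > 0" "2 * h \<le> r" "2 * h < d1" "2 * h < d2" using r d1 d2 by (auto simp: h_def)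
  have sub: "y \<in> V" if "y \<in> cball x (2 * h)" for y using that r(2) h(2) by auto
  obtain y where y: "y \<in> cball x (2 * h)" 
    "F (x + h *\<^sub>R axis a 1 + h *\<^sub>R axis b 1) - F (x + h *\<^sub>R axis a 1) - F (x + h *\<^sub>R axis b 1) + F x
    = h * h * ?B y"
    using second_difference_eq[of x h F a b] Ck(2,3) sub h(1) by blast
  obtain z where z: "z \<in> cball x (2 * h)" 
    "F (x + h *\<^sub>R axis b 1 + h *\<^sub>R axis a 1) - F (x + h *\<^sub>R axis b 1) - F (x + h *\<^sub>R axis a 1) + F x
    = h * h * ?A z"
    using second_difference_eq[of x h F b a] Ck(2,3) sub h(1) by blast
  have swap: "x + h *\<^sub>R axis b 1 + h *\<^sub>R axis a 1 = x + h *\<^sub>R axis a 1 + h *\<^sub>R axis b 1"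
    by simp
  have "h * h * ?B y = h * h * ?A z" using y(2) z(2)[unfolded swap] by linarith
  then have "?B y = ?A z" using h(1) by simp
  moreover have "dist (?B y) (?B x) < e" "dist (?A z) (?A x) < e"
    using d1(2)[of z] d2(2)[of y] y(1) z(1) h by (auto simp: dist_commute)
  moreover have "dist (?A x) (?B x) \<le> dist (?A z) (?A x) + dist (?B y) (?B x)"
    using \<open>?B y = ?A z\<close> dist_triangle3[of "?A x" "?B x" "?A z"] by simp
  moreover have "dist (?A x) (?B x) = 2 * e" by (simp add: e_def dist_real_def)
  ultimately show False by linarith
qed

section \<open>Calculus in a chart and the Ricci identity\<close>

lemma sum_mult_delta [simp]:
  fixes F :: "'i::finite \<Rightarrow> real"
  shows "(\<Sum>m\<in>UNIV. F m * (if m = a then 1 else 0)) = F a"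
    and "(\<Sum>m\<in>UNIV. F m * (if a = m then 1 else 0)) = F a"
    and "(\<Sum>m\<in>UNIV. (if m = a then 1 else 0) * F m) = F a"
    and "(\<Sum>m\<in>UNIV. (if a = m then 1 else 0) * F m) = F a"
  by (simp_all add: if_distrib[of "(*) _"] if_distrib[of "\<lambda>x. x * _"] cong: if_cong)

locale chart_calculus =
  fixes c :: "'m chart"
  assumes open_image: "open (snd c ` fst c)"
    and chart_inv_left: "p \<in> fst c \<Longrightarrow> chart_inv c (snd c p) = p"
begin

definition sm :: "('m \<Rightarrow> real) \<Rightarrow> bool" where
  "sm F \<longleftrightarrow> smooth_on (snd c ` fst c) (F \<circ> chart_inv c)"

lemma sm_cong:
  assumes "\<And>p. p \<in> fst c \<Longrightarrow> F p = G p" "sm F"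
  shows "sm G"
proof -
  have "(F \<circ> chart_inv c) x = (G \<circ> chart_inv c) x" if "x \<in> snd c ` fst c" for x
    using that assms(1) by (auto simp: chart_inv_left)
  then show ?thesis
    using assms(2) Ck_on_cong[OF open_image] unfolding sm_def smooth_on_def by blast
qed

lemma pd_cong:
  assumes "p \<in> fst c" "\<And>q. q \<in> fst c \<Longrightarrow> F q = G q"
  shows "pd c a F p = pd c a G p"
  unfolding pd_def
  by (rule partial_cong_open[OF open_image]) (use assms in \<open>auto simp: chart_inv_left\<close>)

lemma sm_differentiable:
  assumes "sm F" "p \<in> fst c"
  shows "(F \<circ> chart_inv c) differentiable (at (snd c p))"
proof -
  have "Ck_on (Suc 0) (snd c ` fst c) (F \<circ> chart_inv c)" using assms by (auto simp: sm_def smooth_on_def)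
  then show ?thesis using assms(2) by simp
qed

lemma sm_const [simp]: "sm (\<lambda>p. r)"
  by (simp add: sm_def smooth_on_def comp_def Ck_on_const)

lemma sm_add [simp]: "sm F \<Longrightarrow> sm G \<Longrightarrow> sm (\<lambda>p. F p + G p)"
  using Ck_on_add[OF open_image, of _ "F \<circ> chart_inv c" "G \<circ> chart_inv c"]
  by (simp add: sm_def smooth_on_def comp_def)

lemma sm_mult [simp]: "sm F \<Longrightarrow> sm G \<Longrightarrow> sm (\<lambda>p. F p * G p)"
  using Ck_on_mult[OF open_image, of _ "F \<circ> chart_inv c" "G \<circ> chart_inv c"]
  by (simp add: sm_def smooth_on_def comp_def)

lemma sm_inverse:
  assumes "sm F" "\<And>p. p \<in> fst c \<Longrightarrow> F p \<noteq> 0"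
  shows "sm (\<lambda>p. inverse (F p))"
proof -
  have "F (chart_inv c x) \<noteq> 0" if "x \<in> snd c ` fst c" for x
    using that assms(2) by (auto simp: chart_inv_left)
  then show ?thesis
    using assms(1) Ck_on_inverse[OF open_image, of "F \<circ> chart_inv c"]
    unfolding sm_def smooth_on_def comp_def by blast
qed

lemma sm_uminus [simp]: "sm F \<Longrightarrow> sm (\<lambda>p. - F p)"
  using sm_mult[of "\<lambda>p. - 1" F] by simp

lemma sm_diff [simp]: "sm F \<Longrightarrow> sm G \<Longrightarrow> sm (\<lambda>p. F p - G p)"
  using sm_add[of F "\<lambda>p. - G p"] by simp

lemma sm_divide_const [simp]: "sm F \<Longrightarrow> sm (\<lambda>p. F p / r)"
  using sm_mult[of F "\<lambda>p. inverse r"] by (simp add: divide_inverse)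

lemma sm_sum [simp]: "(\<And>i. i \<in> I \<Longrightarrow> sm (F i)) \<Longrightarrow> sm (\<lambda>p. \<Sum>i\<in>I. F i p)"
  by (induction I rule: infinite_finite_induct) auto

lemma sm_prod: "(\<And>i. i \<in> I \<Longrightarrow> sm (F i)) \<Longrightarrow> sm (\<lambda>p. \<Prod>i\<in>I. F i p)"
  by (induction I rule: infinite_finite_induct) auto

lemma sm_pd [simp]:
  assumes "sm F"
  shows "sm (pd c a F)"
proof -
  have "Ck_on k (snd c ` fst c) (partial a (F \<circ> chart_inv c))" for k
    using assms by (metis sm_def smooth_on_def Ck_on.simps(2))
  then have "Ck_on k (snd c ` fst c) (pd c a F \<circ> chart_inv c)" for k
    by (rule Ck_on_cong[OF open_image, rotated]) (auto simp: pd_def chart_inv_left)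
  then show ?thesis by (simp add: sm_def smooth_on_def)
qed

lemma sm_det: "(\<And>i j. sm (F i j)) \<Longrightarrow> sm (\<lambda>p. det (\<chi> i j. F i j p))"
  unfolding det_def by (simp add: sm_prod)

lemma pd_const [simp]: "pd c a (\<lambda>p. r) p = 0"
  by (simp add: pd_def comp_def)

lemma pd_add: "sm F \<Longrightarrow> sm G \<Longrightarrow> p \<in> fst c \<Longrightarrow>
    pd c a (\<lambda>p. F p + G p) p = pd c a F p + pd c a G p"
  using partial_add[OF sm_differentiable sm_differentiable, of F p G]
  by (simp add: pd_def comp_def)

lemma pd_mult: "sm F \<Longrightarrow> sm G \<Longrightarrow> p \<in> fst c \<Longrightarrow>
    pd c a (\<lambda>p. F p * G p) p = pd c a F p * G p + F p * pd c a G p"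
  using partial_mult[OF sm_differentiable sm_differentiable, of F p G]
  by (simp add: pd_def comp_def chart_inv_left)

lemma pd_uminus: "sm F \<Longrightarrow> p \<in> fst c \<Longrightarrow> pd c a (\<lambda>p. - F p) p = - pd c a F p"
  using pd_mult[of "\<lambda>p. - 1" F] by simp

lemma pd_diff: "sm F \<Longrightarrow> sm G \<Longrightarrow> p \<in> fst c \<Longrightarrow>
    pd c a (\<lambda>p. F p - G p) p = pd c a F p - pd c a G p"
  using pd_add[of F "\<lambda>p. - G p"] by (simp add: pd_uminus)

lemma pd_divide_const: "sm F \<Longrightarrow> p \<in> fst c \<Longrightarrow> pd c a (\<lambda>p. F p / r) p = pd c a F p / r"
  using pd_mult[of F "\<lambda>p. inverse r"] by (simp add: divide_inverse)

lemma pd_sum: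
  assumes "\<And>i. i \<in> I \<Longrightarrow> sm (F i)" "p \<in> fst c"
  shows "pd c a (\<lambda>p. \<Sum>i\<in>I. F i p) p = (\<Sum>i\<in>I. pd c a (F i) p)"
  using assms by (induction I rule: infinite_finite_induct) (auto simp: pd_add)

text \<open>The weight of \<open>deltaL_f\<close> is differentiated only here: afterwards
  \<open>deltaL_f_ctr\<close> gives a form without exponentials. Hence differentiability of
  \<open>exp (- f)\<close> is enough.\<close>

lemma pd_exp_mult:
  assumes "sm f" "sm F" "p \<in> fst c"
  shows "pd c a (\<lambda>p. exp (- f p) * F p) p = exp (- f p) * (pd c a F p - pd c a f p * F p)"
proof -
  note d = sm_differentiable[OF assms(1,3)] sm_differentiable[OF assms(2,3)]
  have e: "((\<lambda>y. exp (- y)) has_real_derivative - exp (- y)) (at y)" for y :: real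
    by (auto intro!: derivative_eq_intros)
  have "(\<lambda>x. exp (- (f \<circ> chart_inv c) x)) differentiable (at (snd c p))"
    using d(1) differentiable_compose[of "\<lambda>y. exp (- y)" "f \<circ> chart_inv c"] e
    by (metis real_differentiable_def)
  from partial_mult[OF this d(2), of a] partial_compose_real[OF d(1) e, of a] assms(3)
  show ?thesis by (simp add: pd_def comp_def chart_inv_left algebra_simps)
qed

lemma pd_commute:
  assumes "sm F" "p \<in> fst c"
  shows "pd c a (pd c b F) p = pd c b (pd c a F) p"
proof -
  have "pd c a (pd c b F) p = partial a (partial b (F \<circ> chart_inv c)) (snd c p)" for a b
    unfolding pd_def[of c a]
    by (rule partial_cong_open[OF open_image]) (use assms in \<open>auto simp: pd_def chart_inv_left\<close>)
  then show ?thesis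
    using partial_commute[OF open_image, of "snd c p" "F \<circ> chart_inv c" a b] assms
    by (simp add: sm_def smooth_on_def)
qed

end

section \<open>Metric, inverse metric and Christoffel symbols in one chart\<close>

locale riemannian_chart = chart_calculus c for c :: "'m chart" +
  fixes g :: "'m tensor"
  assumes sm_metric [simp]: "sm (g c [i, j])"
    and metric_sym: "p \<in> fst c \<Longrightarrow> g c [i, j] p = g c [j, i] p"
    and metric_pos: "p \<in> fst c \<Longrightarrow> v \<noteq> 0 \<Longrightarrow> v \<bullet> (metric_matrix g c p *v v) > 0"
begin

abbreviation \<Gamma> where "\<Gamma> \<equiv> christoffel g c"
abbreviation gi where "gi \<equiv> ginv g c"

lemma metric_invertible:
  assumes "p \<in> fst c"
  shows "invertible (metric_matrix g c p)"
  using metric_pos[OF assms] matrix_left_invertible_ker[of "metric_matrix g c p"]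
  by (metis inner_zero_right invertible_left_inverse less_irrefl)

lemma ginv_metric:
  assumes "p \<in> fst c"
  shows "(\<Sum>b\<in>UNIV. gi a b p * g c [b, k] p) = (if a = k then 1 else 0)"
    and "(\<Sum>b\<in>UNIV. g c [a, b] p * gi b k p) = (if a = k then 1 else 0)"
proof -
  let ?M = "metric_matrix g c p"
  have "(matrix_inv ?M ** ?M) $ a $ k = mat 1 $ a $ k" "(?M ** matrix_inv ?M) $ a $ k = mat 1 $ a $ k"
    using someI_ex[OF metric_invertible[OF assms, unfolded invertible_def], folded matrix_inv_def]
    by simp_all
  then show "(\<Sum>b\<in>UNIV. gi a b p * g c [b, k] p) = (if a = k then 1 else 0)"
    and "(\<Sum>b\<in>UNIV. g c [a, b] p * gi b k p) = (if a = k then 1 else 0)"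
    by (simp_all add: matrix_matrix_mult_def mat_def ginv_def metric_matrix_def)
qed

lemma ginv_sym:
  assumes p: "p \<in> fst c"
  shows "gi a b p = gi b a p"
proof -
  have "gi a b p = (\<Sum>k\<in>UNIV. gi a k p * (if k = b then 1 else 0))"
    by simp
  also have "\<dots> = (\<Sum>k\<in>UNIV. gi a k p * (\<Sum>m\<in>UNIV. gi b m p * g c [m, k] p))"
    using ginv_metric(1)[OF p] by (intro sum.cong) auto
  also have "\<dots> = (\<Sum>m\<in>UNIV. gi b m p * (\<Sum>k\<in>UNIV. gi a k p * g c [k, m] p))"
    unfolding sum_distrib_left by (subst sum.swap) (simp add: metric_sym[OF p] mult_ac)
  also have "\<dots> = gi b a p" by (simp add: ginv_metric[OF p])
  finally show ?thesis .
qed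

text \<open>\<open>matrix_inv\<close> is defined by choice, so smoothness is obtained from Cramer's
  rule, which writes each entry as a quotient of determinants of smooth entries.\<close>

lemma sm_ginv [simp]: "sm (gi a b)"
proof (rule sm_cong)
  \<comment> \<open>The metric matrix with column \<open>a\<close> replaced by
    \<open>axis b 1\<close>: the numerator for entry \<open>a\<close> of the solution of M x =
    e_b.\<close>
  let ?N = "\<lambda>p. \<chi> i j. if j = a then axis b 1 $ i else g c [i, j] p"
  let ?d = "\<lambda>p. det (\<chi> i j. g c [i, j] p)"
  have nz: "?d p \<noteq> 0" if "p \<in> fst c" for p
    using metric_invertible[OF that] by (simp add: invertible_det_nz metric_matrix_def)
  have "sm (\<lambda>p. (if j = a then axis b 1 $ i else g c [i, j] p))" for i j
    by (cases "j = a") auto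
  then show "sm (\<lambda>p. det (?N p) * inverse (?d p))"
    using sm_inverse[OF sm_det nz] sm_det[of "\<lambda>i j p. if j = a then axis b 1 $ i else g c [i, j] p"]
    by simp
  fix p assume p: "p \<in> fst c"
  have "metric_matrix g c p *v (\<chi> a. gi a b p) = axis b 1"
    using ginv_metric(2)[OF p] by (simp add: vec_eq_iff matrix_vector_mult_def metric_matrix_def axis_def)
  then show "det (?N p) * inverse (?d p) = gi a b p"
    using nz[OF p] cramer[of "metric_matrix g c p" "\<chi> a. gi a b p" "axis b 1"]
    by (simp add: metric_matrix_def vec_eq_iff divide_inverse cong: if_cong)
qed

lemma sm_christoffel [simp]: "sm (\<Gamma> m a b)"
  unfolding christoffel_def[abs_def] by simp

lemma christoffel_sym:
  assumes "p \<in> fst c"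
  shows "\<Gamma> m a b p = \<Gamma> m b a p"
  unfolding christoffel_def using pd_cong[OF assms, of "g c [a, b]" "g c [b, a]"] metric_sym
  by (simp add: add_ac)

lemma metric_christoffel:
  assumes p: "p \<in> fst c"
  shows "(\<Sum>m\<in>UNIV. g c [k, m] p * \<Gamma> m a b p)
    = (pd c a (g c [k, b]) p + pd c b (g c [k, a]) p - pd c k (g c [a, b]) p) / 2"
proof -
  let ?X = "\<lambda>l. pd c a (g c [l, b]) p + pd c b (g c [l, a]) p - pd c l (g c [a, b]) p"
  have "(\<Sum>m\<in>UNIV. g c [k, m] p * \<Gamma> m a b p) = (\<Sum>m\<in>UNIV. \<Sum>l\<in>UNIV. g c [k, m] p * gi m l p * ?X l) / 2"
    by (simp add: christoffel_def sum_distrib_left sum_divide_distrib mult.assoc)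
  also have "\<dots> = (\<Sum>l\<in>UNIV. (\<Sum>m\<in>UNIV. g c [k, m] p * gi m l p) * ?X l) / 2"
    by (subst sum.swap) (simp add: sum_distrib_right)
  also have "\<dots> = ?X k / 2" by (simp add: ginv_metric[OF p])
  finally show ?thesis .
qed

text \<open>Metric compatibility: in the two lowered Christoffel symbols all derivatives cancel in
  the sum except that in direction \<open>a\<close>.\<close>

lemma pd_metric:
  assumes p: "p \<in> fst c"
  shows "pd c a (g c [i, j]) p
    = (\<Sum>m\<in>UNIV. \<Gamma> m a i p * g c [m, j] p) + (\<Sum>m\<in>UNIV. \<Gamma> m a j p * g c [i, m] p)"
proof -
  have "(\<Sum>m\<in>UNIV. \<Gamma> m a i p * g c [m, j] p) = (\<Sum>m\<in>UNIV. g c [j, m] p * \<Gamma> m a i p)"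
    using metric_sym[OF p] by (simp add: mult.commute)
  moreover have "(\<Sum>m\<in>UNIV. \<Gamma> m a j p * g c [i, m] p) = (\<Sum>m\<in>UNIV. g c [i, m] p * \<Gamma> m a j p)"
    by (simp add: mult.commute)
  moreover have sym: "pd c k (g c [x, y]) p = pd c k (g c [y, x]) p" for k x y
    using pd_cong[OF p] metric_sym by blast
  ultimately show ?thesis
    unfolding metric_christoffel[OF p] sym[of _ j] sym[of _ i a] by simp
qed

text \<open>Differentiate the relation between \<open>gi\<close> and \<open>g\<close> in
  \<open>ginv_metric\<close>, multiply by the inverse once more to isolate the derivative of
  \<open>gi\<close>, and insert metric compatibility.\<close>

lemma pd_ginv:
  assumes p: "p \<in> fst c"
  shows "pd c a (gi i j) p
    = - (\<Sum>m\<in>UNIV. \<Gamma> i a m p * gi m j p) - (\<Sum>m\<in>UNIV. \<Gamma> j a m p * gi i m p)"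
proof -
  have "(\<Sum>b\<in>UNIV. pd c a (gi i b) p * g c [b, k] p) = - (\<Sum>b\<in>UNIV. gi i b p * pd c a (g c [b, k]) p)" for k
  proof -
    have "pd c a (\<lambda>p. \<Sum>b\<in>UNIV. gi i b p * g c [b, k] p) p = pd c a (\<lambda>p. if i = k then 1 else 0) p"
      using ginv_metric(1) by (intro pd_cong[OF p])
    then show ?thesis by (simp add: pd_sum pd_mult p sum.distrib)
  qed
  note * = this
  have "pd c a (gi i j) p = (\<Sum>b\<in>UNIV. pd c a (gi i b) p * (\<Sum>k\<in>UNIV. g c [b, k] p * gi k j p))"
    by (simp add: ginv_metric[OF p])
  also have "\<dots> = (\<Sum>k\<in>UNIV. (\<Sum>b\<in>UNIV. pd c a (gi i b) p * g c [b, k] p) * gi k j p)"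
    unfolding sum_distrib_left sum_distrib_right by (subst sum.swap) (simp add: mult_ac)
  also have "\<dots> = - (\<Sum>k\<in>UNIV. \<Sum>b\<in>UNIV. gi i b p * pd c a (g c [b, k]) p * gi k j p)"
    unfolding * by (simp add: sum_distrib_right sum_negf)
  also have "\<dots> = - (\<Sum>k\<in>UNIV. \<Sum>b\<in>UNIV. \<Sum>m\<in>UNIV. gi i b p * (\<Gamma> m a b p * g c [m, k] p) * gi k j p)
     - (\<Sum>k\<in>UNIV. \<Sum>b\<in>UNIV. \<Sum>m\<in>UNIV. gi i b p * (\<Gamma> m a k p * g c [b, m] p) * gi k j p)"
    unfolding pd_metric[OF p]
    by (simp add: sum_distrib_left sum_distrib_right sum.distrib distrib_left distrib_right)
  also have "(\<Sum>k\<in>UNIV. \<Sum>b\<in>UNIV. \<Sum>m\<in>UNIV. gi i b p * (\<Gamma> m a b p * g c [m, k] p) * gi k j p)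
     = (\<Sum>b\<in>UNIV. \<Sum>m\<in>UNIV. gi i b p * \<Gamma> m a b p * (\<Sum>k\<in>UNIV. g c [m, k] p * gi k j p))"
    unfolding sum_distrib_left
    by (subst sum.swap, rule sum.cong[OF refl], subst sum.swap) (simp add: mult_ac)
  also have "\<dots> = (\<Sum>m\<in>UNIV. \<Gamma> j a m p * gi i m p)"
    unfolding ginv_metric[OF p] by (simp add: mult.commute)
  also have "(\<Sum>k\<in>UNIV. \<Sum>b\<in>UNIV. \<Sum>m\<in>UNIV. gi i b p * (\<Gamma> m a k p * g c [b, m] p) * gi k j p)
     = (\<Sum>k\<in>UNIV. \<Sum>m\<in>UNIV. (\<Sum>b\<in>UNIV. gi i b p * g c [b, m] p) * \<Gamma> m a k p * gi k j p)"
    unfolding sum_distrib_right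
    by (rule sum.cong[OF refl], subst sum.swap) (simp add: mult_ac)
  also have "\<dots> = (\<Sum>m\<in>UNIV. \<Gamma> i a m p * gi m j p)"
    unfolding ginv_metric[OF p] by (simp add: mult.assoc)
  finally show ?thesis by simp
qed

section \<open>Covariant derivatives on index lists and the Ricci identity\<close>

definition smt :: "nat \<Rightarrow> 'm tensor \<Rightarrow> bool" where
  "smt n T \<longleftrightarrow> (\<forall>is. length is = n \<longrightarrow> sm (T c is))"

lemma smtD [simp]: "smt n T \<Longrightarrow> length is = n \<Longrightarrow> sm (T c is)"
  by (simp add: smt_def)

lemma cov_Cons:
  "cov g T c (a # js) p = pd c a (T c js) p
     - (\<Sum>r<length js. \<Sum>m\<in>UNIV. \<Gamma> m a (js ! r) p * T c (js[r := m]) p)"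
  by (simp add: cov_def)

lemma smt_cov [simp]:
  assumes "smt n T"
  shows "smt (Suc n) (cov g T)"
  unfolding smt_def
proof (intro allI impI)
  fix js :: "4 list" assume "length js = Suc n"
  then obtain a ks where "js = a # ks" "length ks = n" by (cases js) auto
  then show "sm (cov g T c js)"
    using assms by (simp add: cov_Cons[abs_def])
qed

text \<open>Makes formulas for a first covariant derivative, valid only at one rank and on the chart
  domain, usable inside a second one.\<close>

lemma cov_cong:
  assumes "\<And>is q. length is = n \<Longrightarrow> q \<in> fst c \<Longrightarrow> T c is q = U c is q"
    and "length js = n" "p \<in> fst c"
  shows "cov g T c (a # js) p = cov g U c (a # js) p"
  unfolding cov_Cons using assms pd_cong[OF assms(3), of "T c js" "U c js" a] by simp

text \<open>\<open>R(\<partial>\<^sub>a, \<partial>\<^sub>b) \<partial>\<^sub>j = curv a b m j \<partial>\<^sub>m\<close>, summed over \<open>m\<close>.\<close>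

definition curv :: "4 \<Rightarrow> 4 \<Rightarrow> 4 \<Rightarrow> 4 \<Rightarrow> 'm \<Rightarrow> real" where
  "curv a b m j p = pd c a (\<Gamma> m b j) p - pd c b (\<Gamma> m a j) p
     + (\<Sum>q\<in>UNIV. \<Gamma> m a q p * \<Gamma> q b j p - \<Gamma> m b q p * \<Gamma> q a j p)"

lemma riem_curv: "riem g c [i, j, k, l] p = (\<Sum>m\<in>UNIV. g c [k, m] p * curv i j m l p)"
  by (simp add: riem_def curv_def)

lemma curv_riem:
  assumes p: "p \<in> fst c"
  shows "curv a b m j p = (\<Sum>k\<in>UNIV. gi m k p * riem g c [a, b, k, j] p)"
proof -
  have "(\<Sum>k\<in>UNIV. gi m k p * riem g c [a, b, k, j] p)
      = (\<Sum>n\<in>UNIV. (\<Sum>k\<in>UNIV. gi m k p * g c [k, n] p) * curv a b n j p)"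
    unfolding riem_curv sum_distrib_left sum_distrib_right
    by (subst sum.swap) (simp add: mult.assoc)
  then show ?thesis unfolding ginv_metric[OF p] by simp
qed

text \<open>In the expansion of the second derivative, the part symmetric in \<open>a\<close> and
  \<open>b\<close> drops out: second partial derivatives, the sum of the two \<open>Y\<close> terms,
  and the Christoffel correction of the derivative index, by torsion-freeness. \<open>X\<close>
  gives the derivative part of \<open>curv\<close>, the diagonal of \<open>h\<close> its quadratic
  part.\<close>

theorem ricci_identity:
  assumes T: "smt (length js) T" and p: "p \<in> fst c"
  shows "cov g (cov g T) c (a # b # js) p - cov g (cov g T) c (b # a # js) p
    = - (\<Sum>r<length js. \<Sum>m\<in>UNIV. curv a b m (js ! r) p * T c (js[r := m]) p)"
proof -
  let ?n = "length js"
  define X where "X a b = (\<Sum>r<?n. \<Sum>m\<in>UNIV. pd c a (\<Gamma> m b (js ! r)) p * T c (js[r := m]) p)" for a b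
  define Y where "Y a b = (\<Sum>r<?n. \<Sum>m\<in>UNIV. \<Gamma> m b (js ! r) p * pd c a (T c (js[r := m])) p)" for a b
  \<comment> \<open>Slot \<open>s\<close> is read after slot \<open>r\<close> has been replaced by
    \<open>m\<close>, so for \<open>r = s\<close> the inner symbol acts on \<open>m\<close> and the
    term becomes an iterated product of Christoffel symbols.\<close>
  define h where "h a b r s = (\<Sum>m\<in>UNIV. \<Sum>k\<in>UNIV. \<Gamma> m a (js ! r) p *
     (\<Gamma> k b (js[r := m] ! s) p * T c (js[r := m, s := k]) p))" for a b r s
  have cc: "cov g (cov g T) c (a # b # js) p = pd c a (pd c b (T c js)) p - X a b - Y a b - Y b a
      - (\<Sum>m\<in>UNIV. \<Gamma> m a b p * cov g T c (m # js) p) + (\<Sum>r<?n. \<Sum>s<?n. h a b r s)" for a b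
  proof -
    have "(\<Sum>r<?n. \<Sum>s<?n. h a b r s) = (\<Sum>r<?n. \<Sum>m\<in>UNIV. \<Gamma> m a (js ! r) p *
        (\<Sum>s<?n. \<Sum>k\<in>UNIV. \<Gamma> k b (js[r := m] ! s) p * T c (js[r := m, s := k]) p))"
      unfolding h_def sum_distrib_left by (subst (2) sum.swap) simp
    then have "(\<Sum>r<?n. \<Sum>m\<in>UNIV. \<Gamma> m a (js ! r) p * cov g T c (b # js[r := m]) p)
        = Y b a - (\<Sum>r<?n. \<Sum>s<?n. h a b r s)"
      unfolding Y_def by (simp add: cov_Cons right_diff_distrib sum_subtractf)
    moreover have "pd c a (cov g T c (b # js)) p = pd c a (pd c b (T c js)) p - X a b - Y a b"
      unfolding cov_Cons[abs_def] X_def Y_def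
      using T p by (simp add: pd_diff pd_sum pd_mult sum.distrib)
    ultimately show ?thesis
      unfolding cov_Cons[of "cov g T"] by (simp add: sum.lessThan_Suc_shift del: sum.lessThan_Suc)
  qed
  \<comment> \<open>Corrections in two different slots act independently, so exchanging
    \<open>a\<close> with \<open>b\<close> and \<open>r\<close> with \<open>s\<close> changes
    nothing and only the diagonal survives antisymmetrization.\<close>
  have off: "h a b r s = h b a s r" if "r \<noteq> s" for r s
    unfolding h_def using that by (subst sum.swap) (simp add: list_update_swap mult_ac)
  have "(\<Sum>r<?n. \<Sum>s<?n. h a b r s) - (\<Sum>r<?n. \<Sum>s<?n. h b a r s)
      = (\<Sum>r<?n. \<Sum>s<?n. h a b r s - h b a s r)"
    using sum.swap[of "h b a" "{..<?n}" "{..<?n}"] by (simp add: sum_subtractf)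
  also have "\<dots> = (\<Sum>r<?n. \<Sum>s<?n. if s = r then h a b r r - h b a r r else 0)"
    using off by (intro sum.cong) auto
  also have "\<dots> = (\<Sum>r<?n. h a b r r - h b a r r)" by simp
  also have "\<dots> = - (\<Sum>r<?n. \<Sum>k\<in>UNIV. (\<Sum>q\<in>UNIV. \<Gamma> k a q p * \<Gamma> q b (js ! r) p
      - \<Gamma> k b q p * \<Gamma> q a (js ! r) p) * T c (js[r := k]) p)"
    unfolding sum_negf[symmetric]
  proof (rule sum.cong[OF refl])
    fix r assume "r \<in> {..<?n}"
    then have "h a b r r = (\<Sum>k\<in>UNIV. \<Sum>q\<in>UNIV. \<Gamma> k b q p * \<Gamma> q a (js ! r) p * T c (js[r := k]) p)" for a b
      unfolding h_def by (subst sum.swap) (simp add: mult_ac)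
    then show "h a b r r - h b a r r = (\<Sum>k\<in>UNIV. - ((\<Sum>q\<in>UNIV. \<Gamma> k a q p * \<Gamma> q b (js ! r) p
      - \<Gamma> k b q p * \<Gamma> q a (js ! r) p) * T c (js[r := k]) p))"
      by (simp add: sum_distrib_right left_diff_distrib sum_subtractf sum_negf)
  qed
  finally have "(\<Sum>r<?n. \<Sum>s<?n. h a b r s) - (\<Sum>r<?n. \<Sum>s<?n. h b a r s) - (X a b - X b a)
      = - (\<Sum>r<?n. \<Sum>m\<in>UNIV. curv a b m (js ! r) p * T c (js[r := m]) p)"
    unfolding X_def curv_def by (simp add: distrib_right left_diff_distrib sum.distrib sum_subtractf)
  moreover have "pd c a (pd c b (T c js)) p = pd c b (pd c a (T c js)) p"
    using pd_commute p T by simp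
  moreover have "\<Gamma> m a b p = \<Gamma> m b a p" for m using christoffel_sym[OF p] .
  ultimately show ?thesis unfolding cc by simp
qed

section \<open>The metric is parallel; symmetries of the Riemann tensor\<close>

lemma smt_metric [simp]: "smt 2 g"
  unfolding smt_def by (auto simp: length_Suc_conv numeral_2_eq_2)

lemma cov_metric:
  assumes p: "p \<in> fst c"
  shows "cov g g c [a, i, j] p = 0"
  using pd_metric[OF p, of a i j] by (simp add: cov_Cons numeral_2_eq_2)

lemma riem_antisym12: "riem g c [j, i, k, l] p = - riem g c [i, j, k, l] p"
proof -
  have "curv j i m l p = - curv i j m l p" for m
    unfolding curv_def by (simp add: sum_subtractf)
  then show ?thesis unfolding riem_curv by (simp add: sum_negf)
qed

text \<open>The Ricci identity for the parallel tensor \<open>g\<close>: its left side vanishes, and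
  the right side is the symmetrization of the curvature in the last two indices.\<close>

lemma riem_antisym34:
  assumes p: "p \<in> fst c"
  shows "riem g c [i, j, l, k] p = - riem g c [i, j, k, l] p"
proof -
  have "cov g (cov g g) c (a # b # [k, l]) p = cov g (\<lambda>_ _ _. 0) c (a # b # [k, l]) p" for a b
    by (rule cov_cong[OF _ _ p, of 3]) (auto simp: length_Suc_conv numeral_3_eq_3 cov_metric)
  moreover have "cov g (\<lambda>_ _ _. 0) c (a # b # [k, l]) p = 0" for a b
    by (simp add: cov_Cons)
  ultimately have "(\<Sum>m\<in>UNIV. curv i j m k p * g c [m, l] p) + (\<Sum>m\<in>UNIV. curv i j m l p * g c [k, m] p) = 0"
    using ricci_identity[of "[k, l]" g p i j] p smt_metric by (simp add: numeral_2_eq_2)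
  then show ?thesis
    unfolding riem_curv using metric_sym[OF p] by (simp add: mult.commute)
qed

text \<open>The cyclic sum runs over slots 1, 2 and 4, since slot 3 holds the lowered index.
  Symmetry of the Christoffel symbols cancels all its terms in pairs.\<close>

lemma riem_bianchi:
  assumes p: "p \<in> fst c"
  shows "riem g c [i, j, k, l] p + riem g c [j, l, k, i] p + riem g c [l, i, k, j] p = 0"
proof -
  have pds: "pd c a (\<Gamma> m i j) p = pd c a (\<Gamma> m j i) p" for a m i j
    using pd_cong[OF p] christoffel_sym by blast
  have "curv i j m l p + curv j l m i p + curv l i m j p = 0" for m
    unfolding curv_def using pds[of i m j l] pds[of j m l i] pds[of l m i j] christoffel_sym[OF p]
    by (simp add: sum_subtractf christoffel_sym[OF p, of _ j i] christoffel_sym[OF p, of _ l j]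
        christoffel_sym[OF p, of _ l i])
  then have "(\<Sum>m\<in>UNIV. g c [k, m] p * (curv i j m l p + curv j l m i p + curv l i m j p)) = 0" by simp
  then show ?thesis unfolding riem_curv by (simp add: distrib_left sum.distrib)
qed

text \<open>The classical consequence of the Bianchi identity: four cyclic identities are combined
  linearly, the antisymmetries matching their terms up to sign.\<close>

lemma riem_pair_sym:
  assumes p: "p \<in> fst c"
  shows "riem g c [k, l, i, j] p = riem g c [i, j, k, l] p"
proof -
  note b = riem_bianchi[OF p]
  note a12 = riem_antisym12[where p = p] and a34 = riem_antisym34[OF p]
  show ?thesis
    using b[of i j k l] b[of j k l i] b[of k l i j] b[of l i j k]
      a12[of j i k l] a12[of j l k i] a12[of l i k j] a12[of k j l i] a12[of j k l i] a12[of i j l k] a12[of i k l j]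
      a12[of k l i j] a12[of l j i k] a12[of j k i l] a12[of l i j k] a12[of i k j l] a12[of k l j i]
      a34[of i j k l] a34[of j l k i] a34[of l i k j] a34[of j k l i]  a34[of k i l j]
      a34[of k l i j] a34[of l j i k] a34[of j k i l] a34[of l i j k] a34[of i k j l] a34[of i k l j] a34[of k i j l] 
    by linarith
qed

end

section \<open>Contractions and covariant derivatives\<close>

context riemannian_chart
begin

text \<open>The trace over a pair of slots is kept as an opaque operator, so that linearity,
  exchange of two traces and expansion in a frame are each proved once instead of inside nested
  sums.\<close>

definition ctr :: "'m \<Rightarrow> (4 \<Rightarrow> 4 \<Rightarrow> real) \<Rightarrow> real" where
  "ctr p F = (\<Sum>x\<in>UNIV. \<Sum>y\<in>UNIV. gi x y p * F x y)"

lemma ctr_add: "ctr p (\<lambda>x y. F x y + G x y) = ctr p F + ctr p G"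
  by (simp add: ctr_def distrib_left sum.distrib)

lemma ctr_diff: "ctr p (\<lambda>x y. F x y - G x y) = ctr p F - ctr p G"
  by (simp add: ctr_def right_diff_distrib sum_subtractf)

lemma ctr_minus: "ctr p (\<lambda>x y. - F x y) = - ctr p F"
  by (simp add: ctr_def sum_negf)

lemma ctr_mult_left: "ctr p (\<lambda>x y. r * F x y) = r * ctr p F"
  by (simp add: ctr_def sum_distrib_left mult.left_commute)

lemma ctr_mult_right: "ctr p (\<lambda>x y. F x y * r) = ctr p F * r"
  by (simp add: ctr_def sum_distrib_right mult.assoc)

lemma ctr_divide: "ctr p (\<lambda>x y. F x y / r) = ctr p F / r"
  by (simp add: ctr_def sum_divide_distrib)

lemma ctr_sum: "ctr p (\<lambda>x y. \<Sum>i\<in>I. F i x y) = (\<Sum>i\<in>I. ctr p (F i))"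
proof -
  have "ctr p (\<lambda>x y. \<Sum>i\<in>I. F i x y) = (\<Sum>x\<in>UNIV. \<Sum>i\<in>I. \<Sum>y\<in>UNIV. gi x y p * F i x y)"
    unfolding ctr_def sum_distrib_left by (rule sum.cong[OF refl], rule sum.swap)
  also have "\<dots> = (\<Sum>i\<in>I. ctr p (F i))" unfolding ctr_def by (rule sum.swap)
  finally show ?thesis .
qed

lemmas ctr_linear = ctr_add ctr_diff ctr_minus ctr_mult_left ctr_mult_right ctr_divide ctr_sum

lemma ctr_swap: "ctr p (\<lambda>a b. ctr p (\<lambda>x y. F a b x y)) = ctr p (\<lambda>x y. ctr p (\<lambda>a b. F a b x y))"
proof -
  have "ctr p (\<lambda>a b. ctr p (\<lambda>x y. F a b x y))
      = (\<Sum>a\<in>UNIV. \<Sum>b\<in>UNIV. gi a b p * ctr p (\<lambda>x y. F a b x y))" by (simp add: ctr_def)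
  also have "\<dots> = ctr p (\<lambda>x y. \<Sum>a\<in>UNIV. \<Sum>b\<in>UNIV. gi a b p * F a b x y)"
    by (simp add: ctr_linear)
  finally show ?thesis by (simp add: ctr_def)
qed

lemma ctr_flip:
  assumes "p \<in> fst c"
  shows "ctr p (\<lambda>x y. F y x) = ctr p F"
  unfolding ctr_def by (subst sum.swap) (simp add: ginv_sym[OF assms])

lemma ctr_metric:
  assumes p: "p \<in> fst c"
  shows "ctr p (\<lambda>x y. g c [i, x] p * F y) = F i"
proof -
  have "ctr p (\<lambda>x y. g c [i, x] p * F y) = (\<Sum>y\<in>UNIV. (\<Sum>x\<in>UNIV. g c [i, x] p * gi x y p) * F y)"
    unfolding ctr_def sum_distrib_right by (subst sum.swap) (simp add: mult_ac)
  then show ?thesis unfolding ginv_metric[OF p] by simp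
qed

lemma sm_ctr [simp]: "(\<And>x y. sm (F x y)) \<Longrightarrow> sm (\<lambda>p. ctr p (\<lambda>x y. F x y p))"
  by (simp add: ctr_def)

text \<open>The derivative of the inverse metric supplies exactly the Christoffel terms of the two contracted
  slots, so contraction commutes with the covariant derivative.\<close>

lemma pd_ctr:
  assumes F: "\<And>x y. sm (F x y)" and p: "p \<in> fst c"
  shows "pd c a (\<lambda>p. ctr p (\<lambda>x y. F x y p)) p = ctr p (\<lambda>x y. pd c a (F x y) p)
    - ctr p (\<lambda>x y. \<Sum>m\<in>UNIV. \<Gamma> m a x p * F m y p) - ctr p (\<lambda>x y. \<Sum>m\<in>UNIV. \<Gamma> m a y p * F x m p)"
proof -
  have "(\<Sum>x\<in>UNIV. \<Sum>y\<in>UNIV. (\<Sum>m\<in>UNIV. \<Gamma> x a m p * gi m y p) * F x y p)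
      = ctr p (\<lambda>x y. \<Sum>m\<in>UNIV. \<Gamma> m a x p * F m y p)"
    (is "?L = _")
  proof -
    have "?L = (\<Sum>y\<in>UNIV. \<Sum>x\<in>UNIV. \<Sum>m\<in>UNIV. \<Gamma> x a m p * gi m y p * F x y p)"
      unfolding sum_distrib_right by (rule sum.swap)
    also have "\<dots> = (\<Sum>y\<in>UNIV. \<Sum>m\<in>UNIV. \<Sum>x\<in>UNIV. \<Gamma> x a m p * gi m y p * F x y p)"
      by (rule sum.cong[OF refl], rule sum.swap)
    also have "\<dots> = (\<Sum>m\<in>UNIV. \<Sum>y\<in>UNIV. \<Sum>x\<in>UNIV. \<Gamma> x a m p * gi m y p * F x y p)"
      by (rule sum.swap)
    finally show ?thesis by (simp add: ctr_def sum_distrib_left mult_ac)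
  qed
  moreover have "(\<Sum>x\<in>UNIV. \<Sum>y\<in>UNIV. (\<Sum>m\<in>UNIV. \<Gamma> y a m p * gi x m p) * F x y p)
      = ctr p (\<lambda>x y. \<Sum>m\<in>UNIV. \<Gamma> m a y p * F x m p)"
    (is "?L = _")
  proof -
    have "?L = (\<Sum>x\<in>UNIV. \<Sum>m\<in>UNIV. \<Sum>y\<in>UNIV. \<Gamma> y a m p * gi x m p * F x y p)"
      unfolding sum_distrib_right by (rule sum.cong[OF refl], rule sum.swap)
    then show ?thesis by (simp add: ctr_def sum_distrib_left mult_ac)
  qed
  moreover have "pd c a (\<lambda>p. ctr p (\<lambda>x y. F x y p)) p
      = (\<Sum>x\<in>UNIV. \<Sum>y\<in>UNIV. pd c a (gi x y) p * F x y p) + ctr p (\<lambda>x y. pd c a (F x y) p)"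
    unfolding ctr_def using F p by (simp add: pd_sum pd_mult sum.distrib)
  ultimately show ?thesis
    unfolding pd_ginv[OF p] by (simp add: left_diff_distrib sum_subtractf sum_negf)
qed

lemmas cov_simps = cov_Cons eval_nat_numeral

text \<open>By \<open>pd_ctr\<close> the Christoffel terms of the traced slots are already present,
  and those of \<open>i\<close> and \<open>k\<close> pass through the trace. Used for
  \<open>U = tr2 g S\<close>; the next lemma, with one more leading slot, handles its covariant
  derivative.\<close>

lemma cov_sym_trace_2:
  assumes T: "smt 4 T" and p: "p \<in> fst c"
    and U: "\<And>i k q. q \<in> fst c \<Longrightarrow>
      U c [i, k] q = ctr q (\<lambda>x y. T c [i, x, k, y] q + T c [k, x, i, y] q) / 2"
  shows "cov g U c [a, i, k] p = ctr p (\<lambda>x y. cov g T c [a, i, x, k, y] p + cov g T c [a, k, x, i, y] p) / 2"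
proof -
  have "pd c a (U c [i, k]) p = pd c a (\<lambda>p. ctr p (\<lambda>x y. T c [i, x, k, y] p + T c [k, x, i, y] p) / 2) p"
    by (rule pd_cong[OF p]) (rule U)
  then show ?thesis
    using T p by (simp add: cov_simps U pd_ctr pd_divide_const pd_add ctr_linear
        distrib_left sum.distrib sum_divide_distrib[symmetric] add_divide_distrib diff_divide_distrib)
qed

lemma cov_sym_trace_3:
  assumes T: "smt 5 T" and p: "p \<in> fst c"
    and U: "\<And>b i k q. q \<in> fst c \<Longrightarrow>
      U c [b, i, k] q = ctr q (\<lambda>x y. T c [b, i, x, k, y] q + T c [b, k, x, i, y] q) / 2"
  shows "cov g U c [a, b, i, k] p
    = ctr p (\<lambda>x y. cov g T c [a, b, i, x, k, y] p + cov g T c [a, b, k, x, i, y] p) / 2"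
proof -
  have "pd c a (U c [b, i, k]) p
      = pd c a (\<lambda>p. ctr p (\<lambda>x y. T c [b, i, x, k, y] p + T c [b, k, x, i, y] p) / 2) p"
    by (rule pd_cong[OF p]) (rule U)
  then show ?thesis
    using T p by (simp add: cov_simps U pd_ctr pd_divide_const pd_add ctr_linear
        distrib_left sum.distrib sum_divide_distrib[symmetric] add_divide_distrib diff_divide_distrib)
qed

text \<open>The same principle for a divergence, where the derivative index is traced with the first
  form index; needed to differentiate \<open>deltaL_f\<close>.\<close>

lemma cov_ctr_slots12:
  assumes T: "smt 5 T" and p: "p \<in> fst c"
    and U: "\<And>j k l q. q \<in> fst c \<Longrightarrow> U c [j, k, l] q = ctr q (\<lambda>x y. T c [x, y, j, k, l] q)"
  shows "cov g U c [a, j, k, l] p = ctr p (\<lambda>x y. cov g T c [a, x, y, j, k, l] p)"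
proof -
  have "pd c a (U c [j, k, l]) p = pd c a (\<lambda>p. ctr p (\<lambda>x y. T c [x, y, j, k, l] p)) p"
    by (rule pd_cong[OF p]) (rule U)
  then show ?thesis
    using T p by (simp add: cov_simps U pd_ctr ctr_linear)
qed

lemma cov_add:
  assumes "smt (length js) T" "smt (length js) U" "p \<in> fst c"
  shows "cov g (\<lambda>c is p. T c is p + U c is p) c (a # js) p = cov g T c (a # js) p + cov g U c (a # js) p"
  using assms by (simp add: cov_Cons pd_add distrib_left sum.distrib)

lemma cov_diff:
  assumes "smt (length js) T" "smt (length js) U" "p \<in> fst c"
  shows "cov g (\<lambda>c is p. T c is p - U c is p) c (a # js) p = cov g T c (a # js) p - cov g U c (a # js) p"
  using assms by (simp add: cov_Cons pd_diff right_diff_distrib sum_subtractf)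

lemma cov_uminus:
  assumes "smt (length js) T" "p \<in> fst c"
  shows "cov g (\<lambda>c is p. - T c is p) c (a # js) p = - cov g T c (a # js) p"
  using assms by (simp add: cov_Cons pd_uminus sum_negf)

lemma cov_scale:
  assumes "sm u" "smt (length js) T" "p \<in> fst c"
  shows "cov g (\<lambda>c is p. u p * T c is p) c (a # js) p = pd c a u p * T c js p + u p * cov g T c (a # js) p"
  using assms by (simp add: cov_Cons pd_mult right_diff_distrib sum_distrib_left mult.left_commute)

text \<open>The product df \<otimes> T. The drift part of \<open>deltaL_f\<close> and the covariant
  derivative of \<open>u g\<close> both have this form, so one Leibniz rule produces both
  Hessians.\<close>

definition grad_tensor :: "('m \<Rightarrow> real) \<Rightarrow> 'm tensor \<Rightarrow> 'm tensor" where
  "grad_tensor f T c' js p = pd c' (hd js) f p * T c' (tl js) p"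

lemma grad_tensor_Cons [simp]: "grad_tensor f T c' (b # js) p = pd c' b f p * T c' js p"
  by (simp add: grad_tensor_def)

lemma smt_grad_tensor [simp]: "sm f \<Longrightarrow> smt n T \<Longrightarrow> smt (Suc n) (grad_tensor f T)"
  by (auto simp: smt_def length_Suc_conv grad_tensor_Cons[abs_def])

lemma cov_scalar: "cov g (scalar f) c [a] p = pd c a f p"
proof -
  have "scalar f c [] = f" by (rule ext) (simp add: scalar_def)
  then show ?thesis by (simp add: cov_Cons)
qed

lemma hess_eq: "hess g f c [a, b] p = pd c a (pd c b f) p - (\<Sum>m\<in>UNIV. \<Gamma> m a b p * pd c m f p)"
  unfolding hess_def cov_Cons[of "cov g (scalar f)"] by (simp add: cov_scalar cov_scalar[abs_def])

lemma cov_grad_tensor: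
  assumes f: "sm f" and T: "smt (length js) T" and p: "p \<in> fst c"
  shows "cov g (grad_tensor f T) c (a # b # js) p
    = hess g f c [a, b] p * T c js p + pd c b f p * cov g T c (a # js) p"
  unfolding cov_Cons hess_eq using assms
  by (simp add: grad_tensor_Cons[abs_def] pd_mult sum.lessThan_Suc_shift sum_distrib_left
      sum_distrib_right algebra_simps del: sum.lessThan_Suc)

lemma lap_ctr: "lap g T c is p = ctr p (\<lambda>a b. cov g (cov g T) c (a # b # is) p)"
  by (simp add: lap_def ctr_def)

lemma cov_grad_ctr: "cov_grad g f T c is p = ctr p (\<lambda>a b. pd c a f p * cov g T c (b # is) p)"
  by (simp add: cov_grad_def ctr_def mult.assoc)

lemma tr2_ctr: "tr2 g T c [i, k] p = ctr p (\<lambda>x y. T c [i, x, k, y] p + T c [k, x, i, y] p) / 2"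
  by (simp add: tr2_def ctr_def)

text \<open>The trace moves through each covariant derivative in turn; it then commutes with the
  trace over the two derivative indices by \<open>ctr_swap\<close>.\<close>

lemma lap_f_tr2:
  assumes S: "smt 4 S" and p: "p \<in> fst c"
  shows "lap_f g f (tr2 g S) c [i, k] p = tr2 g (lap_f g f S) c [i, k] p"
proof -
  have 1: "cov g (tr2 g S) c [b, i, k] q
      = ctr q (\<lambda>x y. cov g S c [b, i, x, k, y] q + cov g S c [b, k, x, i, y] q) / 2"
    if "q \<in> fst c" for b i k q
    by (rule cov_sym_trace_2[OF S that]) (rule tr2_ctr)
  have "smt 5 (cov g S)" using smt_cov[OF S] by simp
  then have 2: "cov g (cov g (tr2 g S)) c [a, b, i, k] p = ctr p (\<lambda>x y.
      cov g (cov g S) c [a, b, i, x, k, y] p + cov g (cov g S) c [a, b, k, x, i, y] p) / 2" for a b i k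
    using p by (rule cov_sym_trace_3) (rule 1)
  have "ctr p (\<lambda>x y. ctr p (\<lambda>a b. cov g (cov g S) c [a, b, i, x, k, y] p))
      = ctr p (\<lambda>a b. ctr p (\<lambda>x y. cov g (cov g S) c [a, b, i, x, k, y] p))" for i k
    by (rule ctr_swap)
  moreover have "ctr p (\<lambda>x y. ctr p (\<lambda>a b. pd c a f p * cov g S c [b, i, x, k, y] p))
      = ctr p (\<lambda>a b. pd c a f p * ctr p (\<lambda>x y. cov g S c [b, i, x, k, y] p))" for i k
    by (subst ctr_swap) (simp add: ctr_mult_left)
  ultimately show ?thesis
    unfolding lap_f_def lap_ctr cov_grad_ctr tr2_ctr 1[OF p] 2
    by (simp add: ctr_linear distrib_left add_divide_distrib diff_divide_distrib)
qed

lemma lap_f_scale_metric: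
  assumes u: "sm u" and p: "p \<in> fst c"
  shows "lap_f g f (\<lambda>c is p. u p * g c is p) c [i, k] p = lap_f g f (scalar u) c [] p * g c [i, k] p"
proof -
  let ?ug = "\<lambda>c is p. u p * g c is p"
  have 1: "cov g ?ug c js q = grad_tensor u g c js q" if q: "q \<in> fst c" and "length js = 3" for js q
  proof -
    obtain b i k where "js = [b, i, k]" using \<open>length js = 3\<close> by (auto simp: numeral_3_eq_3 length_Suc_conv)
    then show ?thesis using cov_scale[OF u, of "[i, k]" g q b] q cov_metric[OF q]
      by (simp add: smt_metric[unfolded numeral_2_eq_2])
  qed
  have 2: "cov g (cov g ?ug) c [a, b, i, k] p = hess g u c [a, b] p * g c [i, k] p" for a b
    using cov_cong[of 3 "cov g ?ug" "grad_tensor u g" "[b, i, k]" p a] 1 p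
      cov_grad_tensor[OF u, of "[i, k]" g p a b] cov_metric[OF p]
    by (simp add: smt_metric[unfolded numeral_2_eq_2])
  show ?thesis
    unfolding lap_f_def lap_ctr cov_grad_ctr 2
    using 1 p by (simp add: hess_def[symmetric] cov_scalar mult.assoc[symmetric] ctr_mult_right left_diff_distrib)
qed

lemma lap_f_add:
  assumes "smt (length is) T" "smt (length is) U" "p \<in> fst c"
  shows "lap_f g f (\<lambda>c is p. T c is p + U c is p) c is p = lap_f g f T c is p + lap_f g f U c is p"
proof -
  let ?TU = "\<lambda>c is p. T c is p + U c is p" and ?dTU = "\<lambda>c is p. cov g T c is p + cov g U c is p"
  have 1: "cov g ?TU c js q = cov g T c js q + cov g U c js q"
    if "q \<in> fst c" "length js = Suc (length is)" for js q
    using that assms by (cases js) (auto simp: cov_add)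
  have 2: "cov g (cov g ?TU) c (a # b # is) p
    = cov g (cov g T) c (a # b # is) p + cov g (cov g U) c (a # b # is) p" for a b
    using cov_cong[of "Suc (length is)" "cov g ?TU" ?dTU "b # is" p a] 1
      cov_add[of "b # is" "cov g T" "cov g U" p a] assms by simp
  show ?thesis
    unfolding lap_f_def lap_ctr cov_grad_ctr 2
    using 1 assms(3) by (simp add: ctr_linear distrib_left)
qed

end

section \<open>The Weitzenboeck formula on a soliton\<close>

context riemannian_chart
begin

lemma cov_exp:
  assumes "sm f" "smt (length js) T" "p \<in> fst c"
  shows "cov g (\<lambda>c is p. exp (- f p) * T c is p) c (a # js) p
    = exp (- f p) * (cov g T c (a # js) p - pd c a f p * T c js p)"
  using assms by (simp add: cov_Cons pd_exp_mult right_diff_distrib sum_distrib_left mult.left_commute)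

lemma deltaL_f_ctr:
  assumes "sm f" "smt (Suc (length is)) T" "p \<in> fst c"
  shows "deltaL_f g f T c is p = - ctr p (\<lambda>a b. cov g T c (a # b # is) p - grad_tensor f T c (a # b # is) p)"
proof -
  have "deltaL g (\<lambda>c is p. exp (- f p) * T c is p) c is p
      = - ctr p (\<lambda>a b. exp (- f p) * (cov g T c (a # b # is) p - pd c a f p * T c (b # is) p))"
    unfolding deltaL_def ctr_def using assms by (simp add: cov_exp)
  then show ?thesis
    by (simp add: deltaL_f_def ctr_mult_left exp_minus)
qed

lemma dL_1: "dL g (Suc 0) T c [i, j, k, l] p = cov g T c [i, j, k, l] p - cov g T c [j, i, k, l] p"
  by (simp add: dL_def atMost_Suc)

lemma dL_2: "dL g 2 T c [b, i, j, k, l] p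
    = cov g T c [b, i, j, k, l] p - cov g T c [i, b, j, k, l] p + cov g T c [j, b, i, k, l] p"
  by (simp add: dL_def atMost_Suc numeral_2_eq_2)

lemma smt_dL_2:
  assumes "smt 4 T"
  shows "smt 5 (dL g 2 T)"
  using smt_cov[OF assms] unfolding smt_def
  by (auto simp: eval_nat_numeral length_Suc_conv dL_2[unfolded numeral_2_eq_2, abs_def])

lemma cov_dL_2:
  assumes T: "smt 4 T" and p: "p \<in> fst c"
  shows "cov g (dL g 2 T) c [a, b, i, j, k, l] p = cov g (cov g T) c [a, b, i, j, k, l] p
    - cov g (cov g T) c [a, i, b, j, k, l] p + cov g (cov g T) c [a, j, b, i, k, l] p"
proof -
  have "smt 5 (cov g T)" using smt_cov[OF T] by simp
  then have sm: "sm (cov g T c [b, i, j, k, l])" for b i j k l by simp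
  show ?thesis
    unfolding cov_Cons[of "dL g 2 T"] cov_Cons[of "cov g T"]
    using p by (simp add: eval_nat_numeral dL_2[unfolded numeral_2_eq_2] dL_2[unfolded numeral_2_eq_2, abs_def]
        sm pd_add pd_diff right_diff_distrib distrib_left sum_subtractf sum.distrib)
qed

text \<open>\<delta>d differentiates in the orders \<open>a, i\<close> and \<open>a, j\<close>,
  d\<delta> in the opposite orders, which pairs the terms into commutators. In the drift part, as in
  Cartan's formula, the derivatives of \<open>S\<close> in directions \<open>i\<close> and
  \<open>j\<close> cancel; the derivative along \<nabla>f joins the rough Laplacian and the Hessian
  remains.\<close>

lemma hodge_lap_f_commutators:
  assumes f: "sm f" and S: "smt 4 S" and p: "p \<in> fst c"
  shows "hodge_lap_f g f 2 S c [i, j, k, l] p = lap_f g f S c [i, j, k, l] p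
    - ctr p (\<lambda>a b. cov g (cov g S) c [a, i, b, j, k, l] p - cov g (cov g S) c [i, a, b, j, k, l] p
        + hess g f c [i, a] p * S c [b, j, k, l] p)
    + ctr p (\<lambda>a b. cov g (cov g S) c [a, j, b, i, k, l] p - cov g (cov g S) c [j, a, b, i, k, l] p
        + hess g f c [j, a] p * S c [b, i, k, l] p)"
proof -
  let ?T = "\<lambda>c is p. cov g S c is p - grad_tensor f S c is p"
  have dS: "smt 5 (cov g S)" "smt 5 (grad_tensor f S)"
    using smt_cov[OF S] smt_grad_tensor[OF f S] by simp_all
  then have T: "smt 5 (\<lambda>c is p. - ?T c is p)" by (simp add: smt_def)
  have div: "cov g (deltaL_f g f S) c [i, j, k, l] p
     = - ctr p (\<lambda>a b. cov g (cov g S) c [i, a, b, j, k, l] p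
         - (hess g f c [i, a] p * S c [b, j, k, l] p + pd c a f p * cov g S c [i, b, j, k, l] p))" for i j
  proof -
    have "cov g (deltaL_f g f S) c [i, j, k, l] p = ctr p (\<lambda>a b. cov g (\<lambda>c is p. - ?T c is p) c [i, a, b, j, k, l] p)"
      by (rule cov_ctr_slots12[OF T p], subst deltaL_f_ctr) (use f S in \<open>simp_all add: ctr_minus[symmetric] eval_nat_numeral\<close>)
    moreover have "cov g (\<lambda>c is p. - ?T c is p) c [i, a, b, j, k, l] p
        = - (cov g (cov g S) c [i, a, b, j, k, l] p - cov g (grad_tensor f S) c [i, a, b, j, k, l] p)" for a b
      using dS p by (subst cov_uminus) (simp_all add: smt_def cov_diff)
    moreover have "cov g (grad_tensor f S) c [i, a, b, j, k, l] p
        = hess g f c [i, a] p * S c [b, j, k, l] p + pd c a f p * cov g S c [i, b, j, k, l] p" for a b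
      using f S p by (subst cov_grad_tensor) (simp_all add: eval_nat_numeral)
    ultimately show ?thesis by (simp only: ctr_minus)
  qed
  have "deltaL_f g f (dL g 2 S) c [i, j, k, l] p
     = - ctr p (\<lambda>a b. cov g (dL g 2 S) c [a, b, i, j, k, l] p - pd c a f p * dL g 2 S c [b, i, j, k, l] p)"
    using f p smt_dL_2[OF S] by (subst deltaL_f_ctr) (simp_all add: eval_nat_numeral)
  then show ?thesis
    unfolding hodge_lap_f_def lap_f_def lap_ctr cov_grad_ctr
    by (simp add: dL_1 div cov_dL_2[OF S p] dL_2 ctr_linear distrib_left right_diff_distrib)
qed

lemma curv_sum:
  assumes p: "p \<in> fst c"
  shows "(\<Sum>m\<in>UNIV. curv a b m j p * F m) = ctr p (\<lambda>m n. riem g c [a, b, n, j] p * F m)"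
  by (simp add: curv_riem[OF p] ctr_def sum_distrib_right mult.assoc)

lemma ric_ctr: "ric g c [i, k] p = ctr p (\<lambda>j l. riem g c [i, j, k, l] p)"
  by (simp add: ric_def ctr_def)

text \<open>The commutator terms left after the Ricci tensor is split off: the first comes from the second form
  index, the other two from the bundle indices.\<close>

definition weitzenboeck :: "'m tensor \<Rightarrow> 4 \<Rightarrow> 4 \<Rightarrow> 4 \<Rightarrow> 4 \<Rightarrow> 'm \<Rightarrow> real" where
  "weitzenboeck S i j k l p = ctr p (\<lambda>a b. ctr p (\<lambda>m n. riem g c [a, i, n, j] p * S c [b, m, k, l] p
     + riem g c [a, i, n, k] p * S c [b, j, m, l] p + riem g c [a, i, n, l] p * S c [b, j, k, m] p))"

lemma commutator_ctr:
  assumes S: "smt 4 S" and p: "p \<in> fst c"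
  shows "ctr p (\<lambda>a b. cov g (cov g S) c [a, i, b, j, k, l] p - cov g (cov g S) c [i, a, b, j, k, l] p)
    = ctr p (\<lambda>a b. ric g c [i, a] p * S c [b, j, k, l] p) - weitzenboeck S i j k l p"
proof -
  \<comment> \<open>The differentiation index \<open>a\<close> meets the first form index
    \<open>b\<close>; the sign comes from exchanging \<open>a\<close> and \<open>i\<close> to reach
    the index order of \<open>ric\<close>.\<close>
  have ric: "ctr p (\<lambda>a b. riem g c [a, i, n, b] p) = - ric g c [i, n] p" for n
    by (subst riem_antisym12) (simp add: ctr_minus ric_ctr)
  have "ctr p (\<lambda>a b. ctr p (\<lambda>m n. riem g c [a, i, n, b] p * S c [m, j, k, l] p))
      = ctr p (\<lambda>m n. ctr p (\<lambda>a b. riem g c [a, i, n, b] p) * S c [m, j, k, l] p)"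
    by (subst ctr_swap) (simp add: ctr_mult_right)
  \<comment> \<open>Here the Ricci tensor carries the second trace index and \<open>S\<close> the
    first; \<open>ctr_flip\<close> restores the usual order.\<close>
  also have "\<dots>
      = - ctr p (\<lambda>a b. ric g c [i, a] p * S c [b, j, k, l] p)"
    using ctr_flip[OF p, of "\<lambda>n m. ric g c [i, n] p * S c [m, j, k, l] p"] by (simp add: ric ctr_minus)
  finally have *: "ctr p (\<lambda>a b. ctr p (\<lambda>m n. riem g c [a, i, n, b] p * S c [m, j, k, l] p))
    = - ctr p (\<lambda>a b. ric g c [i, a] p * S c [b, j, k, l] p)" .
  have "cov g (cov g S) c [a, i, b, j, k, l] p - cov g (cov g S) c [i, a, b, j, k, l] p
    = - (ctr p (\<lambda>m n. riem g c [a, i, n, b] p * S c [m, j, k, l] p)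
       + ctr p (\<lambda>m n. riem g c [a, i, n, j] p * S c [b, m, k, l] p)
       + ctr p (\<lambda>m n. riem g c [a, i, n, k] p * S c [b, j, m, l] p)
       + ctr p (\<lambda>m n. riem g c [a, i, n, l] p * S c [b, j, k, m] p))" for a b
    using ricci_identity[of "[b, j, k, l]" S p a i] S p by (simp add: eval_nat_numeral curv_sum)
  then show ?thesis
    by (simp add: ctr_minus ctr_add ctr_diff * weitzenboeck_def)
qed

text \<open>Each of the two form indices contributes Ric + Hess f = (\<lambda>/2) g; antisymmetry of
  \<open>S\<close> in them adds the two halves to \<lambda>.\<close>

theorem hodge_lap_f_soliton:
  assumes f: "sm f" and S: "smt 4 S" and p: "p \<in> fst c"
    and S12: "\<And>i j k l. S c [j, i, k, l] p = - S c [i, j, k, l] p"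
    and soliton: "\<And>i j. ric g c [i, j] p + hess g f c [i, j] p = lam / 2 * g c [i, j] p"
  shows "hodge_lap_f g f 2 S c [i, j, k, l] p = lap_f g f S c [i, j, k, l] p - lam * S c [i, j, k, l] p
    + weitzenboeck S i j k l p - weitzenboeck S j i k l p"
proof -
  have hess: "hess g f c [i, j] p = lam / 2 * g c [i, j] p - ric g c [i, j] p" for i j
    using soliton[of i j] by simp
  have "ctr p (\<lambda>a b. hess g f c [i, a] p * S c [b, j, k, l] p)
      = lam / 2 * S c [i, j, k, l] p - ctr p (\<lambda>a b. ric g c [i, a] p * S c [b, j, k, l] p)" for i j
    unfolding hess left_diff_distrib ctr_diff mult.assoc ctr_mult_left
    using ctr_metric[OF p, of i "\<lambda>b. S c [b, j, k, l] p"] by simp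
  then show ?thesis
    unfolding hodge_lap_f_commutators[OF f S p] ctr_add commutator_ctr[OF S p]
    using S12[of j i k l] by simp
qed

end

section \<open>The curvature identity in an oriented orthonormal frame\<close>

lemma det_4:
  "det (A::real^4^4) =
     A$1$1 * (A$2$2 * (A$3$3 * A$4$4 - A$3$4 * A$4$3) - A$2$3 * (A$3$2 * A$4$4 - A$3$4 * A$4$2) + A$2$4 * (A$3$2 * A$4$3 - A$3$3 * A$4$2))
   - A$1$2 * (A$2$1 * (A$3$3 * A$4$4 - A$3$4 * A$4$3) - A$2$3 * (A$3$1 * A$4$4 - A$3$4 * A$4$1) + A$2$4 * (A$3$1 * A$4$3 - A$3$3 * A$4$1))
   + A$1$3 * (A$2$1 * (A$3$2 * A$4$4 - A$3$4 * A$4$2) - A$2$2 * (A$3$1 * A$4$4 - A$3$4 * A$4$1) + A$2$4 * (A$3$1 * A$4$2 - A$3$2 * A$4$1))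
   - A$1$4 * (A$2$1 * (A$3$2 * A$4$3 - A$3$3 * A$4$2) - A$2$2 * (A$3$1 * A$4$3 - A$3$3 * A$4$1) + A$2$3 * (A$3$1 * A$4$2 - A$3$2 * A$4$1))"
proof -
  have f1: "finite {2::4, 3, 4}" "1 \<notin> {2::4, 3, 4}" by auto
  have f2: "finite {3::4, 4}" "2 \<notin> {3::4, 4}" by auto
  have f3: "finite {4::4}" "3 \<notin> {4::4}" by auto
  show ?thesis
    unfolding det_def UNIV_4
    unfolding sum_over_permutations_insert[OF f1] sum_over_permutations_insert[OF f2]
      sum_over_permutations_insert[OF f3]
    unfolding permutes_sing
    by (simp add: sign_swap_id permutation_swap_id sign_compose sign_id swap_id_eq permutation_compose algebra_simps)
qed

text \<open>The Levi-Civita symbol, kept as the determinant occurring in \<open>vol\<close>, so that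
  multiplicativity of determinants yields the frame components of the volume form.\<close>

definition eps :: "4 \<Rightarrow> 4 \<Rightarrow> 4 \<Rightarrow> 4 \<Rightarrow> real" where
  "eps i j k l = det (vector [axis i 1, axis j 1, axis k 1, axis l 1] :: real^4^4)"

lemma vector_4: "(vector [x, y, z, w] :: 'a::zero^4) $ 1 = x" "(vector [x, y, z, w] :: 'a::zero^4) $ 2 = y"
  "(vector [x, y, z, w] :: 'a::zero^4) $ 3 = z" "(vector [x, y, z, w] :: 'a::zero^4) $ 4 = w"
  unfolding vector_def by auto

lemma eps_diag: "eps i i k l = 0" "eps i j i l = 0" "eps i j k i = 0"
    "eps i j j l = 0" "eps i j k j = 0" "eps i j k k = 0"
  unfolding eps_def det_4 vector_4 by (simp_all add: algebra_simps)

lemma eps_values: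
    "eps 1 2 3 4 = 1" "eps 1 2 4 3 = - 1" "eps 1 3 2 4 = - 1" "eps 1 3 4 2 = 1"
    "eps 1 4 2 3 = 1" "eps 1 4 3 2 = - 1" "eps 2 1 3 4 = - 1" "eps 2 1 4 3 = 1"
    "eps 2 3 1 4 = 1" "eps 2 3 4 1 = - 1" "eps 2 4 1 3 = - 1" "eps 2 4 3 1 = 1"
    "eps 3 1 2 4 = 1" "eps 3 1 4 2 = - 1" "eps 3 2 1 4 = - 1" "eps 3 2 4 1 = 1"
    "eps 3 4 1 2 = 1" "eps 3 4 2 1 = - 1" "eps 4 1 2 3 = - 1" "eps 4 1 3 2 = 1"
    "eps 4 2 1 3 = 1" "eps 4 2 3 1 = - 1" "eps 4 3 1 2 = - 1" "eps 4 3 2 1 = 1"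
  unfolding eps_def det_4 vector_4 by (simp_all add: axis_def)



definition kron :: "4 \<Rightarrow> 4 \<Rightarrow> real" where "kron i j = (if i = j then 1 else 0)"

definition kn :: "(4 \<Rightarrow> 4 \<Rightarrow> real) \<Rightarrow> (4 \<Rightarrow> 4 \<Rightarrow> real) \<Rightarrow> 4 \<Rightarrow> 4 \<Rightarrow> 4 \<Rightarrow> 4 \<Rightarrow> real" where
  "kn A B i j k l = A i k * B j l - A i l * B j k - A j k * B i l + A j l * B i k"

text \<open>Compositions sum over all ordered pairs of indices. With the factor 1/4 this is
  antisymmetrization of a pair, hence the identity on 2-forms.\<close>

definition id_form :: "4 \<Rightarrow> 4 \<Rightarrow> 4 \<Rightarrow> 4 \<Rightarrow> real" where
  "id_form i j k l = kn kron kron i j k l / 4"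

definition proj_plus :: "4 \<Rightarrow> 4 \<Rightarrow> 4 \<Rightarrow> 4 \<Rightarrow> real" where
  "proj_plus i j k l = (id_form i j k l + eps i j k l / 2) / 2"

definition compose_form (infixl "\<odot>" 70) where
  "compose_form T U i j k l = (\<Sum>a\<in>(UNIV :: 4 set). \<Sum>b\<in>(UNIV :: 4 set). T i j a b * U a b k l :: real)"

lemma sum_mult_kron [simp]:
  "(\<Sum>m\<in>UNIV. F m * kron m a) = F a" "(\<Sum>m\<in>UNIV. F m * kron a m) = F a"
  "(\<Sum>m\<in>UNIV. kron m a * F m) = F a" "(\<Sum>m\<in>UNIV. kron a m * F m) = F a"
  by (simp_all add: kron_def if_distrib[of "(*) _"] if_distrib[of "\<lambda>x. x * _"] cong: if_cong)

lemma compose_assoc: "T \<odot> (U \<odot> V) = (T \<odot> U) \<odot> V"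
proof (intro ext)
  fix i j k l
  have "(T \<odot> (U \<odot> V)) i j k l = (\<Sum>x\<in>UNIV. \<Sum>y\<in>UNIV. T i j (fst x) (snd x) * U (fst x) (snd x) (fst y) (snd y) * V (fst y) (snd y) k l)"
    by (simp add: compose_form_def sum.cartesian_product' UNIV_Times_UNIV[symmetric] sum_distrib_left mult.assoc
      del: UNIV_Times_UNIV)
  also have "\<dots> = ((T \<odot> U) \<odot> V) i j k l"
    by (subst sum.swap) (simp add: compose_form_def sum.cartesian_product' UNIV_Times_UNIV[symmetric] sum_distrib_right mult.assoc
      del: UNIV_Times_UNIV)
  finally show "(T \<odot> (U \<odot> V)) i j k l = ((T \<odot> U) \<odot> V) i j k l" .
qed

lemma compose_id_form: "(T \<odot> id_form) i j k l = (T i j k l - T i j l k) / 2"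
proof -
  have *: "T i j a b * id_form a b k l = (T i j a b * kron b l * kron a k - T i j a b * kron b k * kron a l) / 2" for a b
    by (simp add: id_form_def kn_def field_simps)
  then show ?thesis
    unfolding compose_form_def * by (simp add: sum_subtractf sum_divide_distrib[symmetric] sum_distrib_right[symmetric])
qed

lemma compose_proj_plus:
  "(T \<odot> proj_plus) i j k l
    = (T i j k l - T i j l k) / 4 + (\<Sum>a\<in>UNIV. \<Sum>b\<in>UNIV. T i j a b * eps a b k l) / 4"
proof -
  have "(T \<odot> proj_plus) i j k l = (T \<odot> id_form) i j k l / 2 + (\<Sum>a\<in>UNIV. \<Sum>b\<in>UNIV. T i j a b * eps a b k l) / 4"
    by (simp add: compose_form_def proj_plus_def distrib_left add_divide_distrib sum.distrib sum_divide_distrib)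
  then show ?thesis by (simp add: compose_id_form)
qed

text \<open>Components in an oriented orthonormal frame of a curvature tensor \<open>R\<close> and of an element \<open>S\<close> of
  \<open>\<Lambda>\<^sup>- \<otimes> \<Lambda>\<^sup>+\<close>.\<close>

locale sd_algebra =
  fixes R S :: "4 \<Rightarrow> 4 \<Rightarrow> 4 \<Rightarrow> 4 \<Rightarrow> real"
  assumes R12: "R j i k l = - R i j k l"
    and R34: "R i j l k = - R i j k l"
    and Rpair: "R k l i j = R i j k l"
    and Rbianchi: "R i j k l + R j l k i + R l i k j = 0"
    and S12: "S j i k l = - S i j k l"
    and S34: "S i j l k = - S i j k l"
    and S_asd: "S 1 2 k l = - S 3 4 k l" "S 1 3 k l = S 2 4 k l" "S 1 4 k l = - S 2 3 k l"
    and S_sd: "S i j 1 2 = S i j 3 4" "S i j 1 3 = - S i j 2 4" "S i j 1 4 = S i j 2 3"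
begin

lemma R_diag: "R i i k l = 0" "R i j k k = 0"
  using R12[of i i k l] R34[of i j k k] by auto

lemma S_diag: "S i i k l = 0" "S i j k k = 0"
  using S12[of i i k l] S34[of i j k k] by auto

lemmas R_simps = R_diag
  R12[of 2 1] R12[of 3 1] R12[of 4 1] R12[of 3 2] R12[of 4 2] R12[of 4 3]
  R34[of _ _ 2 1] R34[of _ _ 3 1] R34[of _ _ 4 1] R34[of _ _ 3 2] R34[of _ _ 4 2] R34[of _ _ 4 3]
lemmas Rpair_simps =
  Rpair[of 1 3 1 2] Rpair[of 1 4 1 2] Rpair[of 1 4 1 3] Rpair[of 2 3 1 2] Rpair[of 2 3 1 3]
  Rpair[of 2 3 1 4] Rpair[of 2 4 1 2] Rpair[of 2 4 1 3] Rpair[of 2 4 1 4] Rpair[of 2 4 2 3]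
  Rpair[of 3 4 1 2] Rpair[of 3 4 1 3] Rpair[of 3 4 1 4] Rpair[of 3 4 2 3] Rpair[of 3 4 2 4]

lemmas S_simps = S_diag
  S12[of 2 1] S12[of 3 1] S12[of 4 1] S12[of 3 2] S12[of 4 2] S12[of 4 3]
  S34[of _ _ 2 1] S34[of _ _ 3 1] S34[of _ _ 4 1] S34[of _ _ 3 2] S34[of _ _ 4 2] S34[of _ _ 4 3]
  S_asd S_sd


text \<open>Antisymmetry and pair symmetry leave 21 components; the Bianchi identity adds one
  relation, among those with four distinct indices, solved here for one of them.\<close>

lemma R_1423: "R 1 4 2 3 = R 1 3 2 4 - R 1 2 3 4"
  using Rbianchi[of 1 2 3 4] R34[of 1 3 4 2] R34[of 1 3 2 4] R34[of 1 4 3 2] R34[of 1 4 2 3]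
    R12[of 2 4 3 1] Rpair[of 3 1 2 4] Rpair[of 3 1 2 4] R12[of 3 1 2 4] R12[of 3 1 4 2] R12[of 4 1 3 2]
    Rpair[of 3 2 4 1] Rpair[of 3 2 4 1] R12[of 3 2 4 1] R12[of 3 2 1 4] Rpair[of 2 3 1 4]  R34[of 2 3 4 1] R34[of 2 4 3 1] Rpair[of 2 4 1 3] R34[of 2 4 1 3]
  by linarith


text \<open>Rewrites to the 20 independent components of \<open>R\<close> and the 9 of \<open>S\<close>.\<close>

lemmas component_simps = R_simps Rpair_simps R_1423 S_simps eps_diag eps_values
  mult_zero_left mult_zero_right add_0_left add_0_right mult_minus_left mult_minus_right
  mult_1_left mult_1_right minus_minus minus_zero

definition tr_S :: "4 \<Rightarrow> 4 \<Rightarrow> real" where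
  "tr_S i k = (\<Sum>a\<in>UNIV. S i a k a + S k a i a) / 2"

definition Rscal :: real where "Rscal = (\<Sum>i\<in>UNIV. \<Sum>j\<in>UNIV. R i j i j)"

definition weitz :: "4 \<Rightarrow> 4 \<Rightarrow> 4 \<Rightarrow> 4 \<Rightarrow> real" where
  "weitz i j k l = (\<Sum>a\<in>UNIV. \<Sum>m\<in>UNIV.
     R a i m j * S a m k l + R a i m k * S a j m l + R a i m l * S a j k m)"

lemma S_proj_plus: "S \<odot> proj_plus = S"
proof -
  have "\<forall>k l. (S \<odot> proj_plus) i j k l = S i j k l" for i j
    unfolding forall_4 compose_proj_plus sum_4
    by (intro conjI; simp only: component_simps; simp)
  then show ?thesis by (intro ext) simp
qed

lemma compose_id_S: "S \<odot> id_form = S"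
proof (intro ext)
  fix i j k l
  show "(S \<odot> id_form) i j k l = S i j k l" using S34[of i j l k] by (simp add: compose_id_form)
qed

text \<open>The Kulkarni-Nomizu product of a trace-free symmetric tensor with the metric exchanges \<open>\<Lambda>\<^sup>+\<close> and
  \<open>\<Lambda>\<^sup>-\<close>.\<close>

lemma compose_kn_proj:
  assumes A: "\<And>i j. A i j = A j i" "(\<Sum>i\<in>UNIV. A i i) = 0"
  shows "(S \<odot> kn A kron) \<odot> proj_plus = (\<lambda>i j k l. 0)"
proof -
  have kn: "(S \<odot> kn A kron) i j k l = 2 * (\<Sum>a\<in>UNIV. S i j a l * A a k) - 2 * (\<Sum>a\<in>UNIV. S i j a k * A a l)"
    for i j k l
  proof -
    have "(S \<odot> kn A kron) i j k l = (\<Sum>a\<in>UNIV. \<Sum>b\<in>UNIV.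
        S i j a b * A a k * kron b l - S i j a b * A a l * kron b k - S i j a b * A b k * kron a l + S i j a b * A b l * kron a k)"
      by (simp add: compose_form_def kn_def algebra_simps)
    also have "\<dots> = (\<Sum>a\<in>UNIV. S i j a l * A a k) - (\<Sum>a\<in>UNIV. S i j a k * A a l)
        - (\<Sum>b\<in>UNIV. S i j l b * A b k) + (\<Sum>b\<in>UNIV. S i j k b * A b l)"
      by (simp add: sum_subtractf sum.distrib sum_distrib_right[symmetric])
    finally show ?thesis by (simp add: S34[of _ _ l] S34[of _ _ k] sum_negf)
  qed
  \<comment> \<open>Trace-freeness is used as an elimination of one diagonal entry, so that what
    remains is checked component by component.\<close>
  have A44: "A 4 4 = - A 1 1 - A 2 2 - A 3 3" using assms(2) by (simp add: sum_4)
  have "\<forall>k l. ((S \<odot> kn A kron) \<odot> proj_plus) i j k l = 0" for i j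
    unfolding forall_4 compose_proj_plus kn sum_4
    by (intro conjI; simp only: component_simps A44 A(1)[of 2 1] A(1)[of 3 1] A(1)[of 4 1]
        A(1)[of 3 2] A(1)[of 4 2] A(1)[of 4 3]; simp add: field_simps)
  then show ?thesis by (intro ext) simp
qed

text \<open>\<open>S\<close> absorbs the left projector, the trace-free Ricci part dies against the
  right one, and the scalar part acts on \<open>S\<close> by \<open>r\<close>. So the Weyl tensor
  can be traded for \<open>R\<close>.\<close>

lemma compose_weyl_plus:
  assumes A: "\<And>i j. A i j = A j i" "(\<Sum>i\<in>UNIV. A i i) = 0"
    and W: "\<And>i j k l. W i j k l = R i j k l - kn A kron i j k l / 2 - r * id_form i j k l"
  shows "(S \<odot> (proj_plus \<odot> (W \<odot> proj_plus))) i j k l = ((S \<odot> R) \<odot> proj_plus) i j k l - r * S i j k l"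
proof -
  have "S \<odot> W = (\<lambda>i j k l. (S \<odot> R) i j k l - (S \<odot> kn A kron) i j k l / 2 - r * S i j k l)"
    by (subst (2) compose_id_S[symmetric], intro ext)
      (simp add: compose_form_def W right_diff_distrib sum_subtractf sum_divide_distrib
        sum_distrib_left mult.left_commute)
  then have "((S \<odot> W) \<odot> proj_plus) i j k l
      = ((S \<odot> R) \<odot> proj_plus) i j k l - ((S \<odot> kn A kron) \<odot> proj_plus) i j k l / 2
        - r * (S \<odot> proj_plus) i j k l"
    by (simp add: compose_form_def[of _ proj_plus] left_diff_distrib sum_subtractf sum_divide_distrib
        sum_distrib_left mult.assoc)
  then show ?thesis
    by (simp add: compose_assoc S_proj_plus compose_kn_proj[of A, OF A])
qed

text \<open>The algebraic core: \<open>V\<close> collects the curvature terms of the Hodge Laplacian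
  and of the composition after \<lambda> has cancelled.\<close>

lemma curvature_trace_identity:
  assumes V: "\<And>i j k l. V i j k l = weitz i j k l - weitz j i k l - Rscal / 2 * S i j k l
    + ((S \<odot> R) \<odot> proj_plus) i j k l"
  shows "2 * (\<Sum>j\<in>UNIV. \<Sum>l\<in>UNIV. R i j k l * tr_S j l) = (\<Sum>a\<in>UNIV. V i a k a + V k a i a) / 2"
proof -
  \<comment> \<open>\<open>U = 4 V\<close> is free of divisions, so that the polynomial method \<open>algebra\<close> applies.\<close>
  define U where "U i j k l = 4 * weitz i j k l - 4 * weitz j i k l - 2 * Rscal * S i j k l
    + (S \<odot> R) i j k l - (S \<odot> R) i j l k + (\<Sum>a\<in>UNIV. \<Sum>b\<in>UNIV. (S \<odot> R) i j a b * eps a b k l)"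
    for i j k l
  have V_U: "V i j k l = U i j k l / 4" for i j k l
    unfolding V U_def compose_proj_plus by (simp add: field_simps)
  have "(\<Sum>a\<in>UNIV. V i a k a + V k a i a) = (\<Sum>a\<in>UNIV. U i a k a + U k a i a) / 4"
    unfolding V_U by (simp add: sum_divide_distrib add_divide_distrib)
  \<comment> \<open>The 8 is the 4 in \<open>V_U\<close> times the 2 from halving the symmetrized
    trace of \<open>V\<close>; on the left the factor 2 cancels the half in
    \<open>tr_S\<close>.\<close>
  moreover have "\<forall>i k. 8 * (\<Sum>j\<in>UNIV. \<Sum>l\<in>UNIV. R i j k l * (\<Sum>a\<in>UNIV. S j a l a + S l a j a))
    = (\<Sum>a\<in>UNIV. U i a k a + U k a i a)"
    unfolding forall_4
    by (intro conjI; simp only: sum_4 U_def weitz_def Rscal_def compose_form_def;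
        simp only: component_simps; algebra)
  then have "8 * (\<Sum>j\<in>UNIV. \<Sum>l\<in>UNIV. R i j k l * (\<Sum>a\<in>UNIV. S j a l a + S l a j a))
    = (\<Sum>a\<in>UNIV. U i a k a + U k a i a)" by blast
  moreover have "2 * (\<Sum>j\<in>UNIV. \<Sum>l\<in>UNIV. R i j k l * tr_S j l)
     = (\<Sum>j\<in>UNIV. \<Sum>l\<in>UNIV. R i j k l * (\<Sum>a\<in>UNIV. S j a l a + S l a j a))"
    by (simp add: tr_S_def sum_divide_distrib[symmetric])
  ultimately show ?thesis by linarith
qed

end

section \<open>Orthonormal frames at a point\<close>

text \<open>Gram-Schmidt for the inner product given by \<open>M\<close>, by induction on the set of
  labels that already carry orthonormal vectors.\<close>

lemma exists_orthonormal_basis: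
  fixes M :: "real^'n^'n"
  assumes pos: "\<And>v. v \<noteq> 0 \<Longrightarrow> v \<bullet> (M *v v) > 0" and sym: "\<And>v w. v \<bullet> (M *v w) = w \<bullet> (M *v v)"
  shows "\<exists>E :: 'n \<Rightarrow> real^'n. \<forall>s t. E s \<bullet> (M *v E t) = (if s = t then 1 else 0)"
proof -
  have "\<exists>E :: 'n \<Rightarrow> real^'n. \<forall>s\<in>I. \<forall>t\<in>I. E s \<bullet> (M *v E t) = (if s = t then 1 else 0)"
    if "finite I" for I :: "'n set"
    using that
  proof (induction I)
    case (insert x I)
    then obtain E :: "'n \<Rightarrow> real^'n" where
      E: "\<And>s t. s \<in> I \<Longrightarrow> t \<in> I \<Longrightarrow> E s \<bullet> (M *v E t) = (if s = t then 1 else 0)" by blast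
    \<comment> \<open>The label \<open>x\<close> is still free, so fewer vectors than the dimension
      are in use and they cannot span.\<close>
    have "card I < CARD('n)" using insert.hyps by (metis finite UNIV_I card_seteq not_le subset_UNIV)
    then have "dim (span (E ` I)) < DIM(real^'n)"
      using dim_le_card'[of "E ` I"] card_image_le[of I E] insert.hyps by (simp add: dim_span)
    then have "span (E ` I) \<noteq> UNIV" by (metis dim_UNIV less_irrefl)
    then obtain v where v: "v \<notin> span (E ` I)" by blast
    define w where "w = v - (\<Sum>i\<in>I. (E i \<bullet> (M *v v)) *\<^sub>R E i)"
    have "(\<Sum>i\<in>I. (E i \<bullet> (M *v v)) *\<^sub>R E i) \<in> span (E ` I)"
      by (intro span_sum span_scale span_base) simp
    then have "w \<noteq> 0" using v by (auto simp: w_def)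
    define r where "r = sqrt (w \<bullet> (M *v w))"
    have r: "r > 0" "r * r = w \<bullet> (M *v w)" using pos[OF \<open>w \<noteq> 0\<close>] by (auto simp: r_def)
    have orth: "E j \<bullet> (M *v w) = 0" if "j \<in> I" for j
    proof -
      have "E j \<bullet> (M *v (\<Sum>i\<in>I. (E i \<bullet> (M *v v)) *\<^sub>R E i)) = (\<Sum>i\<in>I. (E i \<bullet> (M *v v)) * (E j \<bullet> (M *v E i)))"
        by (simp add: linear_sum[OF matrix_vector_mul_linear] matrix_vector_mult_scaleR inner_sum_right)
      also have "\<dots> = (\<Sum>i\<in>I. if i = j then E j \<bullet> (M *v v) else 0)"
        using that E by (intro sum.cong) auto
      also have "\<dots> = E j \<bullet> (M *v v)" using that insert.hyps by simp
      finally show ?thesis by (simp add: w_def matrix_vector_mult_diff_distrib inner_diff_right)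
    qed
    have orth': "w \<bullet> (M *v E j) = 0" if "j \<in> I" for j
      using orth[OF that] sym[of w "E j"] by simp
    have "w \<bullet> (M *v w) / (r * r) = 1" using r(1) by (simp flip: r(2))
    then have unit: "(w /\<^sub>R r) \<bullet> (M *v (w /\<^sub>R r)) = 1"
      by (simp add: matrix_vector_mult_scaleR divide_inverse mult_ac)
    show ?case
    proof (intro exI ballI)
      fix s t assume "s \<in> insert x I" "t \<in> insert x I"
      then show "(E(x := w /\<^sub>R r)) s \<bullet> (M *v (E(x := w /\<^sub>R r)) t) = (if s = t then 1 else 0)"
        using insert.hyps E orth orth' unit by (auto simp: matrix_vector_mult_scaleR)
    qed
  qed simp
  from this[of UNIV] show ?thesis by simp
qed

text \<open>Negating one vector keeps orthonormality and changes the sign of the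
  determinant.\<close>

lemma exists_positive_orthonormal_basis:
  fixes M :: "real^4^4"
  assumes pos: "\<And>v. v \<noteq> 0 \<Longrightarrow> v \<bullet> (M *v v) > 0" and sym: "\<And>v w. v \<bullet> (M *v w) = w \<bullet> (M *v v)"
  shows "\<exists>E :: 4 \<Rightarrow> real^4. (\<forall>s t. E s \<bullet> (M *v E t) = (if s = t then 1 else 0)) \<and> det (\<chi> s. E s) > 0"
proof -
  obtain E :: "4 \<Rightarrow> real^4" where E: "\<And>s t. E s \<bullet> (M *v E t) = (if s = t then 1 else 0)"
    using exists_orthonormal_basis[OF assms] by blast
  let ?N = "\<chi> s. E s"
  have "?N ** (M ** transpose ?N) = mat 1"
    using E by (simp add: vec_eq_iff matrix_matrix_mult_def transpose_def mat_def inner_vec_def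
        matrix_vector_mult_def)
  then have "det ?N * det (M ** transpose ?N) = 1" by (metis det_mul det_I)
  then have nz: "det ?N \<noteq> 0" by auto
  show ?thesis
  proof (cases "det ?N > 0")
    case True
    then show ?thesis using E by blast
  next
    case False
    let ?E = "E(1 := - E 1)"
    have "det (\<chi> s. ?E s) = - det ?N" unfolding det_4 by (simp add: algebra_simps)
    moreover have "M *v - E s = - (M *v E s)" for s
      using matrix_vector_mult_scaleR[of M "- 1" "E s"] by simp
    then have "?E s \<bullet> (M *v ?E t) = (if s = t then 1 else 0)" for s t
      using E by auto
    ultimately show ?thesis using False nz by (intro exI[of _ ?E]) auto
  qed
qed

locale framed_point = riemannian_chart c g for c :: "'m chart" and g +
  fixes p and E :: "4 \<Rightarrow> real^4"
  assumes p: "p \<in> fst c"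
    and orthonormal: "E s \<bullet> (metric_matrix g c p *v E t) = (if s = t then 1 else 0)"
    and oriented: "det (\<chi> s. E s) > 0"
begin

abbreviation N :: "real^4^4" where "N \<equiv> \<chi> s. E s"
abbreviation M :: "real^4^4" where "M \<equiv> metric_matrix g c p"

text \<open>Evaluates one covariant slot on the frame vector \<open>E s\<close>; nesting it gives
  frame components, and its linearity carries identities slot by slot.\<close>

definition fr :: "4 \<Rightarrow> (4 \<Rightarrow> real) \<Rightarrow> real" where
  "fr s X = (\<Sum>i\<in>UNIV. E s $ i * X i)"

lemma N_M: "N ** (M ** transpose N) = mat 1"
  using orthonormal by (simp add: vec_eq_iff matrix_matrix_mult_def transpose_def mat_def inner_vec_def
      matrix_vector_mult_def)

lemma M_N: "(M ** transpose N) ** N = mat 1"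
  using N_M matrix_left_right_inverse by blast

text \<open>The rows of \<open>N\<close> are the frame vectors, so orthonormality reads N M N^T = 1,
  which inverts to M^-1 = N^T N.\<close>

lemma gi_frame: "gi a b p = (\<Sum>s\<in>UNIV. E s $ a * E s $ b)"
proof -
  have "matrix_inv M ** M = mat 1"
    using someI_ex[OF metric_invertible[OF p, unfolded invertible_def], folded matrix_inv_def] by simp
  then have "transpose N ** N = (matrix_inv M ** M) ** (transpose N ** N)"
    by simp
  also have "\<dots> = matrix_inv M ** ((M ** transpose N) ** N)"
    by (simp only: matrix_mul_assoc)
  finally have "matrix_inv M = transpose N ** N" unfolding M_N by simp
  then show ?thesis
    by (simp add: ginv_def matrix_matrix_mult_def transpose_def)
qed

lemma ctr_frame: "ctr p F = (\<Sum>s\<in>UNIV. fr s (\<lambda>x. fr s (\<lambda>y. F x y)))"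
proof -
  have "ctr p F = (\<Sum>x\<in>UNIV. \<Sum>y\<in>UNIV. \<Sum>s\<in>UNIV. E s $ x * (E s $ y * F x y))"
    by (simp add: ctr_def gi_frame sum_distrib_right mult.assoc)
  also have "\<dots> = (\<Sum>x\<in>UNIV. \<Sum>s\<in>UNIV. \<Sum>y\<in>UNIV. E s $ x * (E s $ y * F x y))"
    by (rule sum.cong[OF refl], rule sum.swap)
  also have "\<dots> = (\<Sum>s\<in>UNIV. \<Sum>x\<in>UNIV. \<Sum>y\<in>UNIV. E s $ x * (E s $ y * F x y))"
    by (rule sum.swap)
  finally show ?thesis by (simp add: fr_def sum_distrib_left)
qed

text \<open>\<open>M ** transpose N\<close> is the matrix of the dual coframe and recovers
  coordinate components from frame components.\<close>

lemma fr_ext: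
  assumes "\<And>s. fr s X = fr s Y"
  shows "X a = Y a"
proof -
  have "Z a = (\<Sum>s\<in>UNIV. (M ** transpose N) $ a $ s * fr s Z)" for Z
  proof -
    have "(\<Sum>s\<in>UNIV. (M ** transpose N) $ a $ s * fr s Z)
       = (\<Sum>i\<in>UNIV. ((M ** transpose N) ** N) $ a $ i * Z i)"
      unfolding fr_def sum_distrib_left
      by (subst sum.swap) (simp add: matrix_matrix_mult_def[of _ N] sum_distrib_right mult.assoc)
    then show ?thesis unfolding M_N by (simp add: mat_def)
  qed
  note this[of X] this[of Y]
  then show ?thesis using assms by simp
qed

lemma fr_add: "fr s (\<lambda>i. X i + Y i) = fr s X + fr s Y"
  by (simp add: fr_def distrib_left sum.distrib)

lemma fr_diff: "fr s (\<lambda>i. X i - Y i) = fr s X - fr s Y"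
  by (simp add: fr_def right_diff_distrib sum_subtractf)

lemma fr_minus: "fr s (\<lambda>i. - X i) = - fr s X"
  by (simp add: fr_def sum_negf)

lemma fr_mult_left: "fr s (\<lambda>i. r * X i) = r * fr s X"
  by (simp add: fr_def sum_distrib_left mult.left_commute)

lemma fr_mult_right: "fr s (\<lambda>i. X i * r) = fr s X * r"
  by (simp add: fr_def sum_distrib_right mult.assoc)

lemma fr_divide: "fr s (\<lambda>i. X i / r) = fr s X / r"
  by (simp add: fr_def sum_divide_distrib)

lemma fr_sum: "fr s (\<lambda>i. \<Sum>j\<in>J. X j i) = (\<Sum>j\<in>J. fr s (X j))"
  unfolding fr_def sum_distrib_left by (rule sum.swap)

text \<open>Looping as a rewrite rule; the instance \<open>fr_commute[of s]\<close> terminates and moves the slot of \<open>s\<close>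
  innermost.\<close>

lemma fr_commute: "fr s (\<lambda>i. fr t (\<lambda>j. X i j)) = fr t (\<lambda>j. fr s (\<lambda>i. X i j))"
  unfolding fr_def sum_distrib_left by (subst sum.swap) (simp add: mult.left_commute)

lemmas fr_linear = fr_add fr_diff fr_minus fr_mult_left fr_mult_right fr_divide fr_sum

section \<open>Frame components of the metric, the curvature and the tensor operations\<close>

definition fr2 :: "'m tensor \<Rightarrow> 4 \<Rightarrow> 4 \<Rightarrow> real" where
  "fr2 T s t = fr s (\<lambda>i. fr t (\<lambda>j. T c [i, j] p))"

definition fr4 :: "'m tensor \<Rightarrow> 4 \<Rightarrow> 4 \<Rightarrow> 4 \<Rightarrow> 4 \<Rightarrow> real" where
  "fr4 T s t u v = fr s (\<lambda>i. fr t (\<lambda>j. fr u (\<lambda>k. fr v (\<lambda>l. T c [i, j, k, l] p))))"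

lemmas fr_simps = fr2_def fr4_def ctr_frame fr_linear

lemma fr2_metric: "fr2 g = kron"
proof (intro ext)
  fix s t
  have "fr2 g s t = E s \<bullet> (M *v E t)"
    by (simp add: fr2_def fr_def inner_vec_def matrix_vector_mult_def metric_matrix_def mult.commute)
  then show "fr2 g s t = kron s t" by (simp add: orthonormal kron_def)
qed

lemma fr2_ric: "fr2 (ric g) s t = (\<Sum>a\<in>UNIV. fr4 (riem g) s a t a)"
  by (simp add: fr_simps ric_ctr, (simp only: fr_commute[of s])?, (simp only: fr_commute[of t])?)

lemma scal_frame: "scal g c p = (\<Sum>s\<in>UNIV. \<Sum>a\<in>UNIV. fr4 (riem g) s a s a)"
  using ctr_def[of p "\<lambda>i k. ric g c [i, k] p"]
  by (simp add: scal_def fr2_ric[unfolded fr2_def] ctr_frame)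

lemma fr4_kulkarni_nomizu: "fr4 (kulkarni_nomizu A B) = kn (fr2 A) (fr2 B)"
  by (intro ext) (simp add: fr_simps kulkarni_nomizu_def kn_def)

lemma fr4_id2: "fr4 (id2 g) = id_form"
  using fr4_kulkarni_nomizu[of g g]
  by (simp add: fun_eq_iff fr4_def id2_def id_form_def fr2_metric fr_divide)

lemma fr4_weyl: "fr4 (weyl g) s t u v = fr4 (riem g) s t u v - kn (fr2 (ric0 g)) kron s t u v / 2
    - scal g c p / 6 * id_form s t u v"
  unfolding fr4_id2[symmetric] fr2_metric[symmetric] fr4_kulkarni_nomizu[symmetric]
  by (simp add: fr4_def weyl_def fr_linear)

lemma fr2_ric0: "fr2 (ric0 g) s t = fr2 (ric g) s t - scal g c p / 4 * kron s t"
  unfolding fr2_metric[symmetric] by (simp add: fr2_def ric0_def fr_linear)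

text \<open>Linearity of the determinant in each row.\<close>

lemma fr_det:
  "fr v (\<lambda>l. det (vector [axis l 1, y, z, w] :: real^4^4)) = det (vector [E v, y, z, w] :: real^4^4)"
  "fr v (\<lambda>l. det (vector [x, axis l 1, z, w] :: real^4^4)) = det (vector [x, E v, z, w] :: real^4^4)"
  "fr v (\<lambda>l. det (vector [x, y, axis l 1, w] :: real^4^4)) = det (vector [x, y, E v, w] :: real^4^4)"
  "fr v (\<lambda>l. det (vector [x, y, z, axis l 1] :: real^4^4)) = det (vector [x, y, z, E v] :: real^4^4)"
  unfolding det_4 vector_4 fr_def sum_4 by (simp_all add: axis_def algebra_simps)

text \<open>Orthonormality gives only det M (det N)^2 = 1; the orientation of the frame selects the
  sign of the root.\<close>

lemma sqrt_det_metric: "sqrt (det M) * det N = 1"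
proof -
  have "det N * (det M * det N) = 1"
    using arg_cong[OF N_M, of det] by (simp add: det_mul det_transpose)
  then have "det M = 1 / (det N)\<^sup>2" using oriented by (simp add: power2_eq_square field_simps)
  then show ?thesis using oriented by (simp add: real_sqrt_divide)
qed

lemma fr4_vol: "fr4 (vol g) s t u v = eps s t u v"
proof -
  have "fr4 (vol g) s t u v = sqrt (det M) * det (vector [E s, E t, E u, E v] :: real^4^4)"
    by (simp add: fr4_def vol_def fr_mult_left fr_det)
  also have "(vector [E s, E t, E u, E v] :: real^4^4)
      = vector [axis s 1, axis t 1, axis u 1, axis v 1] ** N"
    unfolding vec_eq_iff forall_4
    by (simp add: matrix_matrix_mult_def vector_4 axis_def)
  finally show ?thesis using sqrt_det_metric by (simp add: det_mul eps_def)
qed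

lemma fr4_star: "fr4 (star g) s t u v = eps s t u v / 2"
  unfolding fr4_vol[symmetric] by (simp add: fr4_def star_def fr_divide)

lemma fr4_id_plus: "fr4 (id_plus g) = proj_plus"
  unfolding proj_plus_def[abs_def] fr4_id2[symmetric] fr4_star[symmetric]
  by (intro ext) (simp add: fr4_def id_plus_def fr_linear)

lemma comp2_ctr: "comp2 g T U c [i, j, k, l] p
    = ctr p (\<lambda>a a'. ctr p (\<lambda>b b'. T c [i, j, a, b] p * U c [a', b', k, l] p))"
  by (simp add: comp2_def ctr_def sum_distrib_left mult.assoc)

lemma fr4_comp2: "fr4 (comp2 g T U) = fr4 T \<odot> fr4 U"
proof (intro ext)
  fix s t u v
  show "fr4 (comp2 g T U) s t u v = (fr4 T \<odot> fr4 U) s t u v"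
    by (simp add: fr_simps comp2_ctr compose_form_def, (simp only: fr_commute[of s])?, (simp only: fr_commute[of t])?, (simp only: fr_commute[of u])?, (simp only: fr_commute[of v])?)
qed

lemma fr2_tr2: "fr2 (tr2 g T) s t = (\<Sum>a\<in>UNIV. fr4 T s a t a + fr4 T t a s a) / 2"
  by (simp add: fr_simps tr2_ctr sum.distrib, (simp only: fr_commute[of s])?, (simp only: fr_commute[of t])?)

lemma curv_act_ctr: "curv_act g h c [i, k] p
    = ctr p (\<lambda>j j'. ctr p (\<lambda>l l'. riem g c [i, j, k, l] p * h c [j', l'] p))"
  by (simp add: curv_act_def ctr_def sum_distrib_left mult.assoc)

lemma fr2_curv_act: "fr2 (curv_act g h) s t
    = (\<Sum>a\<in>UNIV. \<Sum>b\<in>UNIV. fr4 (riem g) s a t b * fr2 h a b)"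
  by (simp add: fr_simps curv_act_ctr, (simp only: fr_commute[of s])?, (simp only: fr_commute[of t])?)

lemma fr4_weitzenboeck:
  "fr s (\<lambda>i. fr t (\<lambda>j. fr u (\<lambda>k. fr v (\<lambda>l. weitzenboeck S i j k l p))))
    = (\<Sum>a\<in>UNIV. \<Sum>m\<in>UNIV. fr4 (riem g) a s m t * fr4 S a m u v
       + fr4 (riem g) a s m u * fr4 S a t m v + fr4 (riem g) a s m v * fr4 S a t u m)"
  by (simp add: fr_simps weitzenboeck_def, (simp only: fr_commute[of s])?, (simp only: fr_commute[of t])?, (simp only: fr_commute[of u])?, (simp only: fr_commute[of v])?)

lemma act2_ctr: "act2 g T \<phi> c [i, j] p
    = ctr p (\<lambda>k k'. ctr p (\<lambda>l l'. T c [i, j, k, l] p * \<phi> c [k', l'] p))"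
  by (simp add: act2_def ctr_def sum_distrib_left mult.assoc)

lemma fr2_act2: "fr2 (act2 g T \<phi>) s t = (\<Sum>a\<in>UNIV. \<Sum>b\<in>UNIV. fr4 T s t a b * fr2 \<phi> a b)"
  by (simp add: fr_simps act2_ctr, (simp only: fr_commute[of s])?, (simp only: fr_commute[of t])?)

section \<open>Index symmetries in frame components\<close>

lemma fr_antisym:
  assumes "\<And>i j. X j i = - X i j"
  shows "fr t (\<lambda>i. fr s (\<lambda>j. X i j)) = - fr s (\<lambda>i. fr t (\<lambda>j. X i j))"
proof -
  have "fr t (\<lambda>i. fr s (\<lambda>j. X i j)) = fr s (\<lambda>i. fr t (\<lambda>j. X j i))" by (rule fr_commute)
  also have "(\<lambda>i j. X j i) = (\<lambda>i j. - X i j)" by (intro ext) (rule assms)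
  then have "fr s (\<lambda>i. fr t (\<lambda>j. X j i)) = fr s (\<lambda>i. fr t (\<lambda>j. - X i j))" by metis
  finally show ?thesis by (simp add: fr_minus)
qed

lemma fr4_antisym12:
  assumes "\<And>i j k l. T c [j, i, k, l] p = - T c [i, j, k, l] p"
  shows "fr4 T t s u v = - fr4 T s t u v"
  unfolding fr4_def
proof (rule fr_antisym)
  fix i j
  show "fr u (\<lambda>k. fr v (\<lambda>l. T c [j, i, k, l] p)) = - fr u (\<lambda>k. fr v (\<lambda>l. T c [i, j, k, l] p))"
    by (simp only: assms[of j i] fr_minus)
qed

lemma fr4_antisym34:
  assumes "\<And>i j k l. T c [i, j, l, k] p = - T c [i, j, k, l] p"
  shows "fr4 T s t v u = - fr4 T s t u v"
proof -
  have "fr v (\<lambda>k. fr u (\<lambda>l. T c [i, j, k, l] p)) = - fr u (\<lambda>k. fr v (\<lambda>l. T c [i, j, k, l] p))" for i j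
    by (rule fr_antisym) (rule assms)
  then show ?thesis by (simp add: fr4_def fr_minus)
qed

lemma fr4_pair_sym:
  assumes "\<And>i j k l. T c [k, l, i, j] p = T c [i, j, k, l] p"
  shows "fr4 T u v s t = fr4 T s t u v"
proof -
  have "fr4 T u v s t = fr s (\<lambda>k. fr t (\<lambda>l. fr u (\<lambda>i. fr v (\<lambda>j. T c [i, j, k, l] p))))"
    unfolding fr4_def by (simp only: fr_commute[of u], simp only: fr_commute[of v])
  also have "(\<lambda>k l i j. T c [i, j, k, l] p) = (\<lambda>k l i j. T c [k, l, i, j] p)"
    by (intro ext) (rule assms)
  then have "fr s (\<lambda>k. fr t (\<lambda>l. fr u (\<lambda>i. fr v (\<lambda>j. T c [i, j, k, l] p)))) = fr4 T s t u v"
    unfolding fr4_def by metis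
  finally show ?thesis .
qed

lemma fr4_bianchi:
  assumes "\<And>i j k l. T c [i, j, k, l] p + T c [j, l, k, i] p + T c [l, i, k, j] p = 0"
  shows "fr4 T s t u v + fr4 T t v u s + fr4 T v s u t = 0"
proof -
  have "fr4 T t v u s = fr s (\<lambda>i. fr t (\<lambda>j. fr u (\<lambda>k. fr v (\<lambda>l. T c [j, l, k, i] p))))"
    unfolding fr4_def
    by ((simp only: fr_commute[of s])?, (simp only: fr_commute[of t])?, (simp only: fr_commute[of u])?, (simp only: fr_commute[of v])?)
  moreover have "fr4 T v s u t = fr s (\<lambda>i. fr t (\<lambda>j. fr u (\<lambda>k. fr v (\<lambda>l. T c [l, i, k, j] p))))"
    unfolding fr4_def
    by ((simp only: fr_commute[of s])?, (simp only: fr_commute[of t])?, (simp only: fr_commute[of u])?, (simp only: fr_commute[of v])?)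
  moreover have "fr s (\<lambda>i. fr t (\<lambda>j. fr u (\<lambda>k. fr v (\<lambda>l.
      T c [i, j, k, l] p + T c [j, l, k, i] p + T c [l, i, k, j] p)))) = 0"
    unfolding assms by (simp add: fr_def)
  ultimately show ?thesis by (simp add: fr4_def fr_add)
qed

end

section \<open>The section \<open>S\<close> in the frame and the return to coordinates\<close>

locale framed_section = framed_point +
  fixes S
  assumes S12: "S c [j, i, k, l] p = - S c [i, j, k, l] p"
    and S34: "S c [i, j, l, k] p = - S c [i, j, k, l] p"
    and act2_left: "act2 g (star g) (\<lambda>c is. S c (is @ [k, l])) c [i, j] p = - S c [i, j, k, l] p"
    and act2_right: "act2 g (star g) (\<lambda>c is. S c ([i, j] @ is)) c [k, l] p = S c [i, j, k, l] p"
begin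

text \<open>The duality equation of a slice is evaluated on the frame in its form indices and then
  in the two fixed bundle indices, which is linear. The factor 2 undoes the half in
  \<open>star\<close>.\<close>

lemma fr4_asd:
  "(\<Sum>a\<in>UNIV. \<Sum>b\<in>UNIV. eps s t a b * fr4 S a b u v) = - 2 * fr4 S s t u v"
proof -
  have "fr u (\<lambda>k. fr v (\<lambda>l. fr2 (act2 g (star g) (\<lambda>c is. S c (is @ [k, l]))) s t)) = - fr4 S s t u v"
    unfolding fr2_def act2_left fr4_def fr_minus
    by (simp only: fr_commute[of u], simp only: fr_commute[of v])
  moreover have "fr u (\<lambda>k. fr v (\<lambda>l. fr2 (act2 g (star g) (\<lambda>c is. S c (is @ [k, l]))) s t))
      = (\<Sum>a\<in>UNIV. \<Sum>b\<in>UNIV. eps s t a b * fr4 S a b u v) / 2"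
    unfolding fr2_act2 fr4_star unfolding fr2_def fr4_def
    by (simp add: fr_linear sum_divide_distrib, simp only: fr_commute[of u], simp only: fr_commute[of v])
  ultimately show ?thesis by simp
qed

lemma fr4_sd:
  "(\<Sum>a\<in>UNIV. \<Sum>b\<in>UNIV. eps u v a b * fr4 S s t a b) = 2 * fr4 S s t u v"
proof -
  have "fr s (\<lambda>i. fr t (\<lambda>j. fr2 (act2 g (star g) (\<lambda>c is. S c ([i, j] @ is))) u v)) = fr4 S s t u v"
    unfolding fr2_def act2_right fr4_def ..
  moreover have "fr s (\<lambda>i. fr t (\<lambda>j. fr2 (act2 g (star g) (\<lambda>c is. S c ([i, j] @ is))) u v))
      = (\<Sum>a\<in>UNIV. \<Sum>b\<in>UNIV. eps u v a b * fr4 S s t a b) / 2"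
    unfolding fr2_act2 fr4_star unfolding fr2_def fr4_def
    by (simp add: fr_linear sum_divide_distrib)
  ultimately show ?thesis by simp
qed

sublocale sd_algebra "fr4 (riem g)" "fr4 S"
proof
  note anti = fr4_antisym12[of S, OF S12] fr4_antisym34[of S, OF S34]
  \<comment> \<open>The signs are those of \<star>e12 = e34, \<star>e13 = -e24, \<star>e14 = e23;
    antisymmetry merges the two orders of each complementary pair.\<close>
  show "fr4 S 1 2 k l = - fr4 S 3 4 k l" "fr4 S 1 3 k l = fr4 S 2 4 k l" "fr4 S 1 4 k l = - fr4 S 2 3 k l" for k l
    using fr4_asd[of 1 2 k l] fr4_asd[of 1 3 k l] fr4_asd[of 1 4 k l]
      anti(1)[of 4 3 k l] anti(1)[of 4 2 k l] anti(1)[of 3 2 k l]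
    unfolding sum_4 by (simp_all add: eps_diag eps_values)
  show "fr4 S i j 1 2 = fr4 S i j 3 4" "fr4 S i j 1 3 = - fr4 S i j 2 4" "fr4 S i j 1 4 = fr4 S i j 2 3" for i j
    using fr4_sd[of 1 2 i j] fr4_sd[of 1 3 i j] fr4_sd[of 1 4 i j]
      anti(2)[of i j 4 3] anti(2)[of i j 4 2] anti(2)[of i j 3 2]
    unfolding sum_4 by (simp_all add: eps_diag eps_values)
qed (rule fr4_antisym12 fr4_antisym34 fr4_pair_sym fr4_bianchi riem_antisym12 riem_antisym34[OF p]
    riem_pair_sym[OF p] riem_bianchi[OF p] S12 S34)+

text \<open>\<open>V\<close> will be what the Hodge Laplacian and the composition add to
  \<open>lap_f\<close>, an expression without derivatives of \<open>S\<close>, so the claim can be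
  tested on the frame at \<open>p\<close>.\<close>

theorem curv_act_tr2:
  assumes V: "\<And>i j k l. V c [i, j, k, l] p = weitzenboeck S i j k l p - weitzenboeck S j i k l p
      - lam * S c [i, j, k, l] p
      + comp2 g S (\<lambda>c is p. weyl_plus g c is p + (lam - scal g c p / 3) * id_plus g c is p) c [i, j, k, l] p"
  shows "2 * curv_act g (tr2 g S) c [i, k] p = tr2 g V c [i, k] p"
proof -
  let ?R = "fr4 (riem g)" and ?S = "fr4 S" and ?A = "fr2 (ric0 g)"
  let ?P = "\<lambda>c is p. weyl_plus g c is p + (lam - scal g c p / 3) * id_plus g c is p"
  have scal: "scal g c p = Rscal" by (simp add: Rscal_def scal_frame)
  have A: "?A a b = ?A b a" for a b
    unfolding fr2_ric0 fr2_ric by (simp add: Rpair[of a _ b] kron_def)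
  have A0: "(\<Sum>a\<in>UNIV. ?A a a) = 0"
    unfolding fr2_ric0 fr2_ric by (simp add: sum_subtractf scal Rscal_def kron_def)
  have weyl: "(?S \<odot> fr4 (weyl_plus g)) a b u v
      = ((?S \<odot> ?R) \<odot> proj_plus) a b u v - Rscal / 6 * ?S a b u v" for a b u v
    unfolding weyl_plus_def fr4_comp2 fr4_id_plus
    by (rule compose_weyl_plus[of ?A, OF A A0]) (simp add: fr4_weyl scal)
  have "(?S \<odot> fr4 ?P) a b u v = (?S \<odot> fr4 (weyl_plus g)) a b u v
      + (lam - Rscal / 3) * (?S \<odot> fr4 (id_plus g)) a b u v" for a b u v
  proof -
    have "fr4 ?P a b u v = fr4 (weyl_plus g) a b u v + (lam - Rscal / 3) * fr4 (id_plus g) a b u v" for a b u v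
      unfolding fr4_def scal by (simp only: fr_add fr_mult_left)
    then show ?thesis
      by (simp add: compose_form_def distrib_left sum.distrib sum_distrib_left mult.left_commute)
  qed
  \<comment> \<open>The 1/6 from the scalar part of the curvature and the 1/3 of the statement add
    up to 1/2.\<close>
  then have comp: "(?S \<odot> fr4 ?P) a b u v
      = ((?S \<odot> ?R) \<odot> proj_plus) a b u v + (lam - Rscal / 2) * ?S a b u v" for a b u v
    by (simp add: weyl fr4_id_plus S_proj_plus algebra_simps)
  have "fr4 V s t u v = weitz s t u v - weitz t s u v - Rscal / 2 * ?S s t u v
      + ((?S \<odot> ?R) \<odot> proj_plus) s t u v" for s t u v
  proof -
    have "fr s (\<lambda>i. fr t (\<lambda>j. fr u (\<lambda>k. fr v (\<lambda>l. weitzenboeck S j i k l p)))) = weitz t s u v"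
      using fr4_weitzenboeck[of t s u v S] unfolding weitz_def fr_commute[of s t] by simp
    moreover have "fr s (\<lambda>i. fr t (\<lambda>j. fr u (\<lambda>k. fr v (\<lambda>l. weitzenboeck S i j k l p)))) = weitz s t u v"
      using fr4_weitzenboeck[of s t u v S] unfolding weitz_def by simp
    ultimately have "fr4 V s t u v = weitz s t u v - weitz t s u v - lam * ?S s t u v + fr4 (comp2 g S ?P) s t u v"
      unfolding fr4_def V by (simp add: fr_linear)
    then show ?thesis unfolding fr4_comp2 comp by (simp add: algebra_simps)
  qed
  \<comment> \<open>Equality of all frame components; \<open>fr_ext\<close> then removes the frame
    from one index at a time.\<close>
  from curvature_trace_identity[OF this]
  have "fr s (\<lambda>i. fr t (\<lambda>k. 2 * curv_act g (tr2 g S) c [i, k] p)) = fr s (\<lambda>i. fr t (\<lambda>k. tr2 g V c [i, k] p))"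
    for s t
    using fr2_curv_act[of "tr2 g S" s t] fr2_tr2[of V s t]
    by (simp add: fr2_def fr_mult_left fr2_tr2[unfolded fr2_def] tr_S_def)
  then have "fr t (\<lambda>k. 2 * curv_act g (tr2 g S) c [i, k] p) = fr t (\<lambda>k. tr2 g V c [i, k] p)" for i t
    by (rule fr_ext)
  then show ?thesis by (rule fr_ext)
qed

end

section \<open>The linearized operator\<close>

lemma riemannian_chartI:
  assumes "oriented_atlas A" "riemannian_metric A g" "c \<in> A"
  shows "riemannian_chart c g"
proof
  have hom: "homeomorphism (fst c) (snd c ` fst c) (snd c) (chart_inv c)"
    using assms(1,3) by (simp add: oriented_atlas_def)
  show open_image: "open (snd c ` fst c)" using assms(1,3) by (simp add: oriented_atlas_def)
  show inv: "chart_inv c (snd c p) = p" if "p \<in> fst c" for p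
    using homeomorphism_apply1[OF hom that] .
  interpret chart_calculus c using open_image inv by unfold_locales
  show "sm (g c [i, j])" for i j
    using assms(2,3) by (simp add: sm_def riemannian_metric_def tensor_field_def)
  show "g c [i, j] p = g c [j, i] p" if "p \<in> fst c" for p i j
    using assms(2,3) that unfolding riemannian_metric_def by blast
  show "v \<bullet> (metric_matrix g c p *v v) > 0" if "p \<in> fst c" "v \<noteq> 0" for p v
    using assms(2,3) that unfolding riemannian_metric_def by blast
qed

lemma (in riemannian_chart) exists_frame:
  assumes p: "p \<in> fst c"
  shows "\<exists>E. framed_point c g p E"
proof -
  let ?M = "metric_matrix g c p"
  have "transpose ?M = ?M"
    using metric_sym[OF p] by (simp add: transpose_def metric_matrix_def)
  then have "v \<bullet> (?M *v w) = w \<bullet> (?M *v v)" for v w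
    by (metis dot_lmul_matrix transpose_matrix_vector inner_commute)
  from exists_positive_orthonormal_basis[OF metric_pos[OF p] this]
  obtain E :: "4 \<Rightarrow> real^4" where
    "\<forall>s t. E s \<bullet> (?M *v E t) = (if s = t then 1 else 0)" "det (\<chi> s. E s) > 0" by blast
  then have "framed_point c g p E" using p by unfold_locales auto
  then show ?thesis by blast
qed

theorem proposition8:
  fixes A :: "('m::{t2_space,second_countable_topology}) chart set"
    and g S h :: "'m tensor" and f u :: "'m \<Rightarrow> real" and lam :: real
  assumes "oriented_atlas A"
    and "gradient_ricci_soliton A g f lam"
    and "asd_sd_section A g S"
    and "smooth_function A u"
    and h: "h = (\<lambda>c is p. u p * g c is p + tr2 g S c is p)"
  shows "\<forall>c\<in>A. \<forall>p\<in>fst c. \<forall>i k.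
    L_op g f h c [i, k] p =
      lap_f g f (scalar u) c [] p * g c [i, k] p + 2 * u p * ric g c [i, k] p
      + tr2 g (\<lambda>c is p. hodge_lap_f g f 2 S c is p
          + comp2 g S (\<lambda>c is p. weyl_plus g c is p + (lam - scal g c p / 3) * id_plus g c is p) c is p)
        c [i, k] p"
proof (intro ballI allI)
  fix c p i k
  assume c: "c \<in> A" and p: "p \<in> fst c"
  interpret riemannian_chart c g
    using riemannian_chartI[OF assms(1) _ c] assms(2) by (simp add: gradient_ricci_soliton_def)
  have f: "sm f" and u: "sm u" and S: "smt 4 S"
    using assms(2-4) c
    by (auto simp: gradient_ricci_soliton_def smooth_function_def asd_sd_section_def tensor_field_def sm_def smt_def)
  have soliton: "ric g c [i, j] p + hess g f c [i, j] p = lam / 2 * g c [i, j] p" for i j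
    using assms(2) c p by (auto simp: gradient_ricci_soliton_def)
  obtain E where "framed_point c g p E" using exists_frame[OF p] by blast
  then interpret framed_point c g p E .
  have asd: "anti_self_dual A g (\<lambda>c is. S c (is @ [k, l]))"
    and sd: "self_dual A g (\<lambda>c is. S c ([k, l] @ is))" for k l
    using assms(3) unfolding asd_sd_section_def by blast+
  interpret framed_section c g p E S
  proof
    fix i j k l
    have "S c ([j, i] @ [k, l]) p = - S c ([i, j] @ [k, l]) p"
      using asd[of k l] c p unfolding anti_self_dual_def two_form_def by blast
    then show "S c [j, i, k, l] p = - S c [i, j, k, l] p" by simp
    have "S c ([i, j] @ [l, k]) p = - S c ([i, j] @ [k, l]) p"
      using sd[of i j] c p unfolding self_dual_def two_form_def by blast
    then show "S c [i, j, l, k] p = - S c [i, j, k, l] p" by simp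
    have "act2 g (star g) (\<lambda>c is. S c (is @ [k, l])) c [i, j] p = - S c ([i, j] @ [k, l]) p"
      using asd[of k l] c p unfolding anti_self_dual_def by blast
    then show "act2 g (star g) (\<lambda>c is. S c (is @ [k, l])) c [i, j] p = - S c [i, j, k, l] p" by simp
    have "act2 g (star g) (\<lambda>c is. S c ([i, j] @ is)) c [k, l] p = S c ([i, j] @ [k, l]) p"
      using sd[of i j] c p unfolding self_dual_def by blast
    then show "act2 g (star g) (\<lambda>c is. S c ([i, j] @ is)) c [k, l] p = S c [i, j, k, l] p" by simp
  qed

  let ?comp = "comp2 g S (\<lambda>c is p. weyl_plus g c is p + (lam - scal g c p / 3) * id_plus g c is p)"
  \<comment> \<open>Subtracting \<open>lap_f\<close> leaves a remainder which, by
    \<open>hodge_lap_f_soliton\<close>, is algebraic in the curvature and \<open>S\<close> at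
    \<open>p\<close>.\<close>
  define V :: "'m tensor" where "V = (\<lambda>c is p. hodge_lap_f g f 2 S c is p + ?comp c is p - lap_f g f S c is p)"
  have V: "V c [i, j, k, l] p = weitzenboeck S i j k l p - weitzenboeck S j i k l p
      - lam * S c [i, j, k, l] p + ?comp c [i, j, k, l] p" for i j k l
    unfolding V_def using hodge_lap_f_soliton[OF f S p S12 soliton] by simp
  have tr2_V: "tr2 g (\<lambda>c is p. hodge_lap_f g f 2 S c is p + ?comp c is p) c [i, k] p
      = tr2 g (lap_f g f S) c [i, k] p + tr2 g V c [i, k] p"
    unfolding V_def tr2_ctr by (simp add: add_divide_distrib[symmetric] ctr_add[symmetric] add.assoc)

  have sm: "smt 2 (\<lambda>c is p. u p * g c is p)" "smt 2 (tr2 g S)"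
    using u S by (auto simp: smt_def numeral_2_eq_2 length_Suc_conv tr2_ctr[abs_def] eval_nat_numeral)
  have "lap_f g f h c [i, k] p
      = lap_f g f (scalar u) c [] p * g c [i, k] p + tr2 g (lap_f g f S) c [i, k] p"
    unfolding h using lap_f_add[of "[i, k]" _ _ p f] sm p
    by (simp add: numeral_2_eq_2 lap_f_scale_metric[OF u p] lap_f_tr2[OF S p])
  moreover have "curv_act g h c [i, k] p = u p * ric g c [i, k] p + curv_act g (tr2 g S) c [i, k] p"
  proof -
    \<comment> \<open>Inserting the metric contracts the second and fourth curvature indices, which
      is Ric; the factor 2 in \<open>L_op\<close> turns it into the term 2 u Ric.\<close>
    have "ctr p (\<lambda>l l'. riem g c [i, j, k, l] p * g c [j', l'] p) = riem g c [i, j, k, j'] p" for j j'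
      using ctr_metric[OF p, of j' "\<lambda>l. riem g c [i, j, k, l] p"]
        ctr_flip[OF p, of "\<lambda>l' l. riem g c [i, j, k, l] p * g c [j', l'] p"] by (simp add: mult.commute)
    then have "ctr p (\<lambda>j j'. ctr p (\<lambda>l l'. riem g c [i, j, k, l] p * (u p * g c [j', l'] p))) = u p * ric g c [i, k] p"
      by (simp add: mult.left_commute[of _ "u p"] ctr_mult_left ric_ctr)
    then show ?thesis by (simp add: h curv_act_ctr distrib_left ctr_add)
  qed
  ultimately show "L_op g f h c [i, k] p =
      lap_f g f (scalar u) c [] p * g c [i, k] p + 2 * u p * ric g c [i, k] p
      + tr2 g (\<lambda>c is p. hodge_lap_f g f 2 S c is p + ?comp c is p) c [i, k] p"
    unfolding L_op_def tr2_V using curv_act_tr2[of V lam i k, OF V] by simp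
qed

end
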